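(* Let $n\ge2$, let $\Sigma^n$ be a complete Riemannian manifold with Ricci curvature globally bounded from below, and let $\psi:\Sigma^n\to\mathbb H^{n+1}$ be a vertical graph in the $(n+1)$-dimensional hyperbolic space $\mathbb H^{n+1}=\mathbb R\times_{e^t}\mathbb R^n$, with constant mean curvature $0\le H\le1$. Let $h$ be its height function and $N$ its unit normal field with $\langle N,\partial_t\rangle<0$. If $$h\le-\log(1+\langle N,\partial_t\rangle)$$ on $\Sigma$, where the right-hand side is interpreted as $+\infty$ at points where $\langle N,\partial_t\rangle=-1$, then: (a) $H=1$ on $\Sigma$. (b) If the closure of the image of the Lorentz Gauss map of $\psi$ with respect to $N$ is contained in $\mathcal H^{n+1}$, then the scalar curvature $R$ of $\Sigma$ is nonpositive and not globally bounded away from zero, i.e. $R\le0$ on $\Sigma$ and there is no constant $\alpha>0$ with $R\le-\alpha$ on all of $\Sigma$.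
   Context: Warped product model: $\mathbb H^{n+1}=\mathbb R\times_{e^t}\mathbb R^n$ is the manifold $\mathbb R\times\mathbb R^n$ with the Riemannian metric $\langle\,,\rangle=dt^2+e^{2t}\langle\,,\rangle_{\mathbb R^n}$, where $\langle\,,\rangle_{\mathbb R^n}$ is the Euclidean metric; it is isometric to hyperbolic space of constant curvature $-1$. $\partial_t$ is the coordinate vector field of the first factor. The fibers $\{t_0\}\times\mathbb R^n$ are horospheres. A vertical graph is an immersion of the form $\psi(x)=(u(x),x)$ for a smooth function $u:\mathbb R^n\to[0,+\infty)$, so that $\Sigma$ is identified with $\mathbb R^n$ (the fiber $\{0\}\times\mathbb R^n$) endowed with the metric induced by $\psi$. The height function $h:\Sigma\to\mathbb R$ is the restriction to $\Sigma$ of the projection onto the first factor; thus $h=u\ge0$. $\Sigma$ is oriented by the unit normal $N$ with $\langle N,V\rangle<0$, where $V=e^t\partial_t$, equivalently $\langle N,\partial_t\rangle<0$. With $\overline\nabla$ the Levi-Civita connection of $\mathbb H^{n+1}$, the shape operator is $AX=-\overline\nabla_XN$ and $H=\mathrm{tr}(A)/n$ (so the fibers, oriented by $-\partial_t$, have $H=1$). Lorentz model and Lorentz Gauss map: let $\mathbb L^{n+2}$ be $\mathbb R^{n+2}$ with the metric $\langle v,w\rangle=\sum_{i=1}^{n+1}v_iw_i-v_{n+2}w_{n+2}$, let $\mathbb S_1^{n+1}=\{p\in\mathbb L^{n+2}:\langle p,p\rangle=1\}$ be de Sitter space, and fix a nonzero null vector $a\in\mathbb L^{n+2}$ with $\langle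 a,e_{n+2}\rangle>0$, $e_{n+2}=(0,\dots,0,1)$. The Steady State space is regarded as the open region $\mathcal H^{n+1}=\{p\in\mathbb S_1^{n+1}:\langle p,a\rangle>0\}$. The Lorentz model of hyperbolic space is $\{p\in\mathbb L^{n+2}:\langle p,p\rangle=-1,\ p_{n+2}>0\}$ with the induced metric. For $\tau>0$, $L_\tau=\{p:\langle p,a\rangle=\tau\}$ (in the Lorentz model) is a horosphere, with unit normal field $\xi_p=p+\frac1\tau a\in\mathcal H^{n+1}$. Let $\Phi$ be an isometry from the warped product model onto the Lorentz model carrying the fibers $\{t_0\}\times\mathbb R^n$ to the horospheres $L_\tau$, with $\Phi_*((\partial_t)_q)=\xi_{\Phi(q)}$. The Lorentz Gauss map of $\Sigma$ with respect to $N$ is the map $\Sigma\to\mathcal H^{n+1}$, $p\mapsto-\Phi_*(N_p)$, where $\Phi_*(N_p)$ is regarded as a vector in $\mathbb L^{n+2}$. The closure of its image is taken in $\mathbb S_1^{n+1}$. *)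

theory Defs
  imports "HOL-Analysis.Analysis"
begin

section \<open>Smooth maps between Euclidean spaces\<close>

primrec Ck_map :: "nat \<Rightarrow> ('a::euclidean_space \<Rightarrow> 'b::real_normed_vector) \<Rightarrow> bool" where
  "Ck_map 0 f \<longleftrightarrow> continuous_on UNIV f"
| "Ck_map (Suc k) f \<longleftrightarrow>
     (\<forall>x. f differentiable (at x)) \<and> (\<forall>v. Ck_map k (\<lambda>x. frechet_derivative f (at x) v))"

definition smooth_map :: "('a::euclidean_space \<Rightarrow> 'b::real_normed_vector) \<Rightarrow> bool" where
  "smooth_map f \<longleftrightarrow> (\<forall>k. Ck_map k f)"

section \<open>Riemannian geometry in one global chart\<close>

text \<open>
  Both the ambient space and the hypersurface are manifolds with a single global chart. Each is
  represented by a Euclidean space \<open>'a\<close>, every tangent space being identified with \<open>'a\<close>, and a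
  metric is a function with \<open>G p v w\<close> the inner product of the vectors \<open>v\<close>, \<open>w\<close> at the point \<open>p\<close>.
\<close>

type_synonym 'a riem_metric = "'a \<Rightarrow> 'a \<Rightarrow> 'a \<Rightarrow> real"

definition trace_op :: "('a::euclidean_space \<Rightarrow> 'a) \<Rightarrow> real" where
  "trace_op T = (\<Sum>b\<in>Basis. T b \<bullet> b)"

text \<open>Metric dual of a linear form; well defined because metrics are positive definite.\<close>

definition sharp :: "'a::euclidean_space riem_metric \<Rightarrow> 'a \<Rightarrow> ('a \<Rightarrow> real) \<Rightarrow> 'a" where
  "sharp G p \<phi> = (THE v. \<forall>z. G p v z = \<phi> z)"

text \<open>
  Christoffel symbols of the Levi-Civita connection: the Koszul formula for the constant
  (hence commuting) vector fields \<open>v\<close>, \<open>w\<close>, \<open>z\<close>.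
\<close>

definition christoffel :: "'a::euclidean_space riem_metric \<Rightarrow> 'a \<Rightarrow> 'a \<Rightarrow> 'a \<Rightarrow> 'a" where
  "christoffel G p v w = sharp G p (\<lambda>z.
     (frechet_derivative (\<lambda>q. G q w z) (at p) v
    + frechet_derivative (\<lambda>q. G q v z) (at p) w
    - frechet_derivative (\<lambda>q. G q v w) (at p) z) / 2)"

text \<open>Covariant derivative, in direction \<open>v\<close> at \<open>x\<close>, of a vector field \<open>Y\<close> along a map \<open>f\<close>.\<close>

definition cov_along ::
  "'b::euclidean_space riem_metric \<Rightarrow> ('a::euclidean_space \<Rightarrow> 'b) \<Rightarrow> ('a \<Rightarrow> 'b) \<Rightarrow> 'a \<Rightarrow> 'a \<Rightarrow> 'b" where
  "cov_along G f Y x v =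
     frechet_derivative Y (at x) v + christoffel G (f x) (frechet_derivative f (at x) v) (Y x)"

definition cov :: "'a::euclidean_space riem_metric \<Rightarrow> ('a \<Rightarrow> 'a) \<Rightarrow> 'a \<Rightarrow> 'a \<Rightarrow> 'a" where
  "cov G Y p v = frechet_derivative Y (at p) v + christoffel G p v (Y p)"

text \<open>
  \<open>R(x,y)z = \<nabla>\<^sub>x\<nabla>\<^sub>y z - \<nabla>\<^sub>y\<nabla>\<^sub>x z\<close> for constant vector fields, for which \<open>[x,y] = 0\<close>. With this
  sign convention and the trace below, round spheres have positive Ricci curvature.
\<close>

definition curvature :: "'a::euclidean_space riem_metric \<Rightarrow> 'a \<Rightarrow> 'a \<Rightarrow> 'a \<Rightarrow> 'a \<Rightarrow> 'a" where
  "curvature G p x y z =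
     cov G (\<lambda>q. cov G (\<lambda>_. z) q y) p x - cov G (\<lambda>q. cov G (\<lambda>_. z) q x) p y"

definition ricci :: "'a::euclidean_space riem_metric \<Rightarrow> 'a \<Rightarrow> 'a \<Rightarrow> 'a \<Rightarrow> real" where
  "ricci G p y z = trace_op (\<lambda>x. curvature G p x y z)"

definition scalar_curvature :: "'a::euclidean_space riem_metric \<Rightarrow> 'a \<Rightarrow> real" where
  "scalar_curvature G p = trace_op (\<lambda>v. sharp G p (ricci G p v))"

definition ricci_bounded_below :: "'a::euclidean_space riem_metric \<Rightarrow> bool" where
  "ricci_bounded_below G \<longleftrightarrow> (\<exists>c. \<forall>p v. ricci G p v v \<ge> c * G p v v)"

definition curve_length :: "'a::euclidean_space riem_metric \<Rightarrow> (real \<Rightarrow> 'a) \<Rightarrow> real" where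
  "curve_length G \<gamma> = integral {0..1}
     (\<lambda>t. sqrt (G (\<gamma> t) (vector_derivative \<gamma> (at t)) (vector_derivative \<gamma> (at t))))"

definition riem_dist :: "'a::euclidean_space riem_metric \<Rightarrow> 'a \<Rightarrow> 'a \<Rightarrow> real" where
  "riem_dist G p q =
     Inf {curve_length G \<gamma> |\<gamma>. valid_path \<gamma> \<and> pathstart \<gamma> = p \<and> pathfinish \<gamma> = q}"

text \<open>
  \<open>riem_dist G\<close> is a metric, as the locale constant below presupposes, whenever \<open>G\<close> is a smooth
  positive definite metric tensor; so this says that every Cauchy sequence converges.
\<close>

definition riem_complete :: "'a::euclidean_space riem_metric \<Rightarrow> bool" where
  "riem_complete G \<longleftrightarrow> Metric_space.mcomplete UNIV (riem_dist G)"

section \<open>Immersed hypersurfaces\<close>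

definition induced_metric ::
  "'b::euclidean_space riem_metric \<Rightarrow> ('a::euclidean_space \<Rightarrow> 'b) \<Rightarrow> 'a riem_metric" where
  "induced_metric G \<psi> = (\<lambda>x v w.
     G (\<psi> x) (frechet_derivative \<psi> (at x) v) (frechet_derivative \<psi> (at x) w))"

definition unit_normal_field ::
  "'b::euclidean_space riem_metric \<Rightarrow> ('a::euclidean_space \<Rightarrow> 'b) \<Rightarrow> ('a \<Rightarrow> 'b) \<Rightarrow> bool" where
  "unit_normal_field G \<psi> N \<longleftrightarrow> smooth_map N \<and>
     (\<forall>x. G (\<psi> x) (N x) (N x) = 1 \<and> (\<forall>v. G (\<psi> x) (N x) (frechet_derivative \<psi> (at x) v) = 0))"

text \<open>
  The tangent vector \<open>AX\<close> with \<open>d\<psi>(AX) = - \<nabla>\<^sub>X N\<close>, where \<open>\<nabla>\<close> is the ambient connection; for a unit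
  normal field \<open>N\<close> of an immersed hypersurface the right-hand side is tangent.
\<close>

definition shape_operator ::
  "'b::euclidean_space riem_metric \<Rightarrow> ('a::euclidean_space \<Rightarrow> 'b) \<Rightarrow> ('a \<Rightarrow> 'b) \<Rightarrow> 'a \<Rightarrow> 'a \<Rightarrow> 'a" where
  "shape_operator G \<psi> N x v =
     (THE w. frechet_derivative \<psi> (at x) w = - cov_along G \<psi> N x v)"

definition mean_curvature ::
  "'b::euclidean_space riem_metric \<Rightarrow> ('a::euclidean_space \<Rightarrow> 'b) \<Rightarrow> ('a \<Rightarrow> 'b) \<Rightarrow> 'a \<Rightarrow> real" where
  "mean_curvature G \<psi> N x = trace_op (shape_operator G \<psi> N x) / real DIM('a)"

section \<open>The warped product model of hyperbolic space\<close>

definition warped_metric :: "(real \<times> 'a::euclidean_space) riem_metric" where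
  "warped_metric p v w = fst v * fst w + (exp (fst p))\<^sup>2 * (snd v \<bullet> snd w)"

definition d_t :: "real \<times> 'a::euclidean_space" where
  "d_t = (1, 0)"

definition vertical_graph :: "('a::euclidean_space \<Rightarrow> real) \<Rightarrow> 'a \<Rightarrow> real \<times> 'a" where
  "vertical_graph u x = (u x, x)"

definition height :: "('a::euclidean_space \<Rightarrow> real \<times> 'a) \<Rightarrow> 'a \<Rightarrow> real" where
  "height \<psi> x = fst (\<psi> x)"

section \<open>The Lorentz model and the Lorentz Gauss map\<close>

text \<open>
  With \<open>'a\<close> of dimension \<open>n\<close>, the space \<open>(real \<times> 'a) \<times> real\<close> is Lorentz-Minkowski space of dimension
  \<open>n + 2\<close>; its last factor is the timelike coordinate.
\<close>

type_synonym 'a lspace = "(real \<times> 'a) \<times> real"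

definition lorentz :: "'a::euclidean_space lspace \<Rightarrow> 'a lspace \<Rightarrow> real" where
  "lorentz v w = fst v \<bullet> fst w - snd v * snd w"

definition e_last :: "'a::euclidean_space lspace" where
  "e_last = (0, 1)"

definition de_sitter :: "'a::euclidean_space lspace set" where
  "de_sitter = {p. lorentz p p = 1}"

definition steady_state :: "'a::euclidean_space lspace \<Rightarrow> 'a lspace set" where
  "steady_state a = {p \<in> de_sitter. lorentz p a > 0}"

definition lorentz_hyperbolic :: "'a::euclidean_space lspace set" where
  "lorentz_hyperbolic = {p. lorentz p p = -1 \<and> snd p > 0}"

definition horosphere :: "'a::euclidean_space lspace \<Rightarrow> real \<Rightarrow> 'a lspace set" where
  "horosphere a \<tau> = {p \<in> lorentz_hyperbolic. lorentz p a = \<tau>}"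

text \<open>The normal \<open>\<xi>\<close> at \<open>p\<close> of the horosphere through \<open>p\<close>, i.e. \<open>\<tau> = lorentz p a\<close>.\<close>

definition horosphere_normal :: "'a::euclidean_space lspace \<Rightarrow> 'a lspace \<Rightarrow> 'a lspace" where
  "horosphere_normal a p = p + (1 / lorentz p a) *\<^sub>R a"

definition admissible_null_vector :: "'a::euclidean_space lspace \<Rightarrow> bool" where
  "admissible_null_vector a \<longleftrightarrow> a \<noteq> 0 \<and> lorentz a a = 0 \<and> lorentz a e_last > 0"

definition model_isometry ::
  "'a::euclidean_space lspace \<Rightarrow> (real \<times> 'a \<Rightarrow> 'a lspace) \<Rightarrow> bool" where
  "model_isometry a \<Phi> \<longleftrightarrow>
     smooth_map \<Phi> \<and> bij_betw \<Phi> UNIV lorentz_hyperbolic \<and>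
     (\<forall>q v w. lorentz (frechet_derivative \<Phi> (at q) v) (frechet_derivative \<Phi> (at q) w)
        = warped_metric q v w) \<and>
     (\<forall>t\<^sub>0. \<exists>\<tau>>0. \<Phi> ` ({t\<^sub>0} \<times> UNIV) = horosphere a \<tau>) \<and>
     (\<forall>q. frechet_derivative \<Phi> (at q) d_t = horosphere_normal a (\<Phi> q))"

definition lorentz_gauss_map ::
  "(real \<times> 'a::euclidean_space \<Rightarrow> 'a lspace) \<Rightarrow> ('a \<Rightarrow> real \<times> 'a) \<Rightarrow> ('a \<Rightarrow> real \<times> 'a)
     \<Rightarrow> 'a \<Rightarrow> 'a lspace" where
  "lorentz_gauss_map \<Phi> \<psi> N x = - frechet_derivative \<Phi> (at (\<psi> x)) (N x)"

end

theory Submission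
  imports Defs
begin

text \<open>
  In the upper half-space model the hypersurface is the entire Euclidean graph of
  \<open>f = exp (- u) \<in> (0, 1]\<close>. With \<open>W = sqrt (1 + |\<nabla>f|\<^sup>2)\<close>, \<open>P = f \<nabla>\<^sup>2f\<close> and
  \<open>K = I - \<nabla>f \<otimes> \<nabla>f / W\<^sup>2\<close> the shape operator is \<open>(I + K P) / W\<close>, so that
  \<open>n H W = n + tr (K P)\<close>. Since \<open>f\<close> is bounded below, minimising \<open>f + \<epsilon>|x|\<^sup>2\<close> gives points where
  \<open>\<nabla>f\<close> is small and \<open>\<nabla>\<^sup>2f\<close> almost nonnegative, whence \<open>H \<ge> 1\<close>. If \<open>H = 1\<close>, the Gauss equation
  reads \<open>R = n - tr A\<^sup>2\<close>, which is nonpositive by Cauchy-Schwarz. Since \<open>f\<close> is bounded above,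
  maximising \<open>f - \<epsilon>|x|\<^sup>2\<close> gives points where \<open>\<nabla>f\<close> is small and \<open>\<nabla>\<^sup>2f\<close> almost nonpositive; there
  \<open>tr (K P) = n (W - 1) \<ge> 0\<close> forces \<open>\<nabla>\<^sup>2f\<close> itself to be small, so \<open>R\<close> comes arbitrarily close to \<open>0\<close>.
\<close>

section \<open>Second and third derivatives of smooth functions\<close>

lemma smooth_map_differentiable:
  assumes "smooth_map f" shows "f differentiable (at x)"
proof -
  have "Ck_map (Suc 0) f" using assms unfolding smooth_map_def by blast
  then show ?thesis by simp
qed

lemma smooth_map_frechet_derivative:
  assumes "smooth_map f" shows "smooth_map (\<lambda>x. frechet_derivative f (at x) v)"
  unfolding smooth_map_def
proof
  fix k
  have "Ck_map (Suc k) f" using assms unfolding smooth_map_def by blast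
  then show "Ck_map k (\<lambda>x. frechet_derivative f (at x) v)" by simp
qed

lemma smooth_map_has_derivative:
  assumes "smooth_map f" shows "(f has_derivative frechet_derivative f (at x)) (at x)"
  using smooth_map_differentiable[OF assms] frechet_derivative_works by blast

lemma has_derivative_along_line:
  fixes f :: "'a::real_normed_vector \<Rightarrow> real"
  assumes "\<And>x. (f has_derivative f' x) (at x)"
  shows "((\<lambda>t. f (p + t *\<^sub>R v)) has_real_derivative f' (p + t *\<^sub>R v) v) (at t)"
proof -
  have l: "linear (f' (p + t *\<^sub>R v))"
    using assms has_derivative_linear by blast
  have "((\<lambda>t. f (p + t *\<^sub>R v)) has_derivative (\<lambda>h. f' (p + t *\<^sub>R v) (h *\<^sub>R v))) (at t)"
    by (rule has_derivative_compose[OF _ assms]) (auto intro!: derivative_eq_intros)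
  then show ?thesis
    unfolding has_field_derivative_def by (simp add: linear_scale[OF l] mult.commute[of _ "f' _ _"])
qed

text \<open>The mean value theorem is applied twice: first along \<open>v\<close> to the increment
  in direction \<open>w\<close>, then along \<open>w\<close> to \<open>f' _ v\<close>. The left-hand
  side is symmetric in \<open>v\<close> and \<open>w\<close>, which makes the two mixed derivatives
  comparable.\<close>

lemma second_difference_mean_value:
  fixes f :: "'a::real_normed_vector \<Rightarrow> real"
  assumes f: "\<And>x. (f has_derivative f' x) (at x)"
    and fv: "\<And>x. ((\<lambda>x. f' x v) has_derivative f'' x) (at x)"
    and "h > 0"
  obtains a b where "0 < a" "a < h" "0 < b" "b < h"
    "f (p + h *\<^sub>R v + h *\<^sub>R w) - f (p + h *\<^sub>R v) - f (p + h *\<^sub>R w) + f p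
      = h * h * f'' (p + a *\<^sub>R v + b *\<^sub>R w) w"
proof -
  let ?r = "\<lambda>t. f (p + h *\<^sub>R w + t *\<^sub>R v) - f (p + t *\<^sub>R v)"
  have "\<And>t. (?r has_real_derivative f' (p + h *\<^sub>R w + t *\<^sub>R v) v - f' (p + t *\<^sub>R v) v) (at t)"
    by (intro DERIV_diff has_derivative_along_line f)
  from MVT2[OF \<open>h > 0\<close> this] obtain a where a: "0 < a" "a < h"
    and ra: "?r h - ?r 0 = h * (f' (p + h *\<^sub>R w + a *\<^sub>R v) v - f' (p + a *\<^sub>R v) v)"
    by auto
  have "\<And>t. ((\<lambda>t. f' (p + a *\<^sub>R v + t *\<^sub>R w) v) has_real_derivative
      f'' (p + a *\<^sub>R v + t *\<^sub>R w) w) (at t)"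
    by (rule has_derivative_along_line[OF fv])
  from MVT2[OF \<open>h > 0\<close> this] obtain b where b: "0 < b" "b < h"
    and rb: "f' (p + a *\<^sub>R v + h *\<^sub>R w) v - f' (p + a *\<^sub>R v) v = h * f'' (p + a *\<^sub>R v + b *\<^sub>R w) w"
    by auto
  have "?r h - ?r 0 = h * (h * f'' (p + a *\<^sub>R v + b *\<^sub>R w) w)"
    using ra rb by (simp add: add_ac)
  with a b that show ?thesis by (simp add: algebra_simps)
qed

text \<open>Schwarz's theorem. The symmetric second difference is \<open>h * h\<close> times either
  mixed derivative at a point near \<open>p\<close>, so values of the two near \<open>p\<close>
  coincide, and continuity forces equality at \<open>p\<close>.\<close>

lemma frechet_derivative_commute:
  fixes f :: "'a::euclidean_space \<Rightarrow> real"
  assumes f: "smooth_map f"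
  shows "frechet_derivative (\<lambda>x. frechet_derivative f (at x) v) (at p) w
       = frechet_derivative (\<lambda>x. frechet_derivative f (at x) w) (at p) v" (is "?A v w p = ?A w v p")
proof (rule ccontr)
  have d1: "\<And>x. (f has_derivative frechet_derivative f (at x)) (at x)"
    by (rule smooth_map_has_derivative[OF f])
  have d2: "\<And>v x. ((\<lambda>x. frechet_derivative f (at x) v) has_derivative (\<lambda>w. ?A v w x)) (at x)"
    using smooth_map_has_derivative[OF smooth_map_frechet_derivative[OF f]] by simp
  have c: "isCont (?A v w) p" for v w
    by (intro differentiable_imp_continuous_within smooth_map_differentiable
        smooth_map_frechet_derivative f)
  assume ne: "?A v w p \<noteq> ?A w v p"
  \<comment> \<open>Half the gap: one number within \<open>e\<close> of both values contradicts the
    triangle inequality.\<close>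
  define e where "e = \<bar>?A v w p - ?A w v p\<bar> / 2"
  have "e > 0" using ne by (simp add: e_def)
  obtain r1 where r1: "r1 > 0" "\<And>x. dist x p < r1 \<Longrightarrow> dist (?A v w x) (?A v w p) < e"
    using c[of v w, unfolded continuous_at_eps_delta] \<open>e > 0\<close> by blast
  obtain r2 where r2: "r2 > 0" "\<And>x. dist x p < r2 \<Longrightarrow> dist (?A w v x) (?A w v p) < e"
    using c[of w v, unfolded continuous_at_eps_delta] \<open>e > 0\<close> by blast
  define r where "r = min r1 r2"
  \<comment> \<open>Small enough that the intermediate points stay within \<open>r\<close> of
    \<open>p\<close>; the summand 1 keeps the denominator positive even for
    \<open>v = w = 0\<close>.\<close>
  define h where "h = r / (norm v + norm w + 1)"
  have pos: "norm v + norm w + 1 > 0" by (simp add: add_nonneg_pos)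
  have h: "h > 0" using r1 r2 pos by (simp add: h_def r_def)
  have close: "dist (p + a *\<^sub>R x + b *\<^sub>R y) p < r"
    if "0 < a" "a < h" "0 < b" "b < h" "norm x + norm y = norm v + norm w" for a b x y
  proof -
    have "dist (p + a *\<^sub>R x + b *\<^sub>R y) p \<le> a * norm x + b * norm y"
      using norm_triangle_ineq[of "a *\<^sub>R x" "b *\<^sub>R y"] that by (simp add: dist_norm add.assoc)
    also have "\<dots> \<le> h * norm x + h * norm y"
      using that by (intro add_mono mult_right_mono) auto
    also have "\<dots> = h * (norm v + norm w)" using that by (simp flip: distrib_left)
    also have "\<dots> < h * (norm v + norm w + 1)" using h by simp
    also have "\<dots> = r" using pos by (simp add: h_def)
    finally show ?thesis .
  qed
  obtain a b where ab: "0 < a" "a < h" "0 < b" "b < h" and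
    e1: "f (p + h *\<^sub>R v + h *\<^sub>R w) - f (p + h *\<^sub>R v) - f (p + h *\<^sub>R w) + f p
      = h * h * ?A v w (p + a *\<^sub>R v + b *\<^sub>R w)"
    by (rule second_difference_mean_value[OF d1 d2 h])
  obtain a' b' where ab': "0 < a'" "a' < h" "0 < b'" "b' < h" and
    e2: "f (p + h *\<^sub>R w + h *\<^sub>R v) - f (p + h *\<^sub>R w) - f (p + h *\<^sub>R v) + f p
      = h * h * ?A w v (p + a' *\<^sub>R w + b' *\<^sub>R v)"
    by (rule second_difference_mean_value[OF d1 d2 h])
  have "h * h * ?A v w (p + a *\<^sub>R v + b *\<^sub>R w) = h * h * ?A w v (p + a' *\<^sub>R w + b' *\<^sub>R v)"
    using e1 e2 by (simp add: algebra_simps)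
  then have eq: "?A v w (p + a *\<^sub>R v + b *\<^sub>R w) = ?A w v (p + a' *\<^sub>R w + b' *\<^sub>R v)"
    (is "?l = ?r") using h by simp
  have "dist ?l (?A v w p) < e"
    using close[OF ab] by (intro r1) (simp add: r_def)
  moreover have "dist ?l (?A w v p) < e"
    unfolding eq using close[OF ab', of w v] by (intro r2) (simp add: r_def)
  ultimately have "dist (?A v w p) (?A w v p) < 2 * e"
    using dist_triangle3[of "?A v w p" "?A w v p" ?l] by linarith
  then show False by (simp add: e_def dist_real_def)
qed

text \<open>\<open>G\<close>, \<open>S\<close>, \<open>T\<close> are the Euclidean gradient of \<open>u\<close> and its first two derivatives.\<close>

locale three_jet =
  fixes u :: "'a::euclidean_space \<Rightarrow> real" and G :: "'a \<Rightarrow> 'a"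
    and S :: "'a \<Rightarrow> 'a \<Rightarrow> 'a" and T :: "'a \<Rightarrow> 'a \<Rightarrow> 'a \<Rightarrow> 'a"
  assumes du: "(u has_derivative (\<lambda>v. G p \<bullet> v)) (at p)"
    and dG: "(G has_derivative S p) (at p)"
    and dS: "((\<lambda>p. S p y) has_derivative (\<lambda>v. T p v y)) (at p)"
    and S_sym: "S p v \<bullet> w = S p w \<bullet> v"
    and T_sym: "T p v w = T p w v"

text \<open>Each derivative is assembled from its coordinates in the standard basis. Symmetry of
  \<open>S\<close> is Schwarz's theorem for \<open>u\<close>, symmetry of \<open>T\<close> the same
  theorem for the first partial derivatives of \<open>u\<close>.\<close>

lemma smooth_map_three_jet:
  fixes u :: "'a::euclidean_space \<Rightarrow> real"
  assumes u: "smooth_map u"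
  obtains G S T where "three_jet u G S T"
proof -
  define D1 where "D1 z p = frechet_derivative u (at p) z" for z p
  define D2 where "D2 z v p = frechet_derivative (D1 z) (at p) v" for z v p
  define D3 where "D3 z v w p = frechet_derivative (D2 z v) (at p) w" for z v w p
  have s1: "smooth_map (D1 z)" for z
    unfolding D1_def by (rule smooth_map_frechet_derivative[OF u])
  have s2: "smooth_map (D2 z v)" for z v
    unfolding D2_def by (rule smooth_map_frechet_derivative[OF s1])
  have d0: "(u has_derivative (\<lambda>v. D1 v p)) (at p)" for p
    using smooth_map_has_derivative[OF u] by (simp add: D1_def)
  have d1: "(D1 z has_derivative (\<lambda>v. D2 z v p)) (at p)" for z p
    using smooth_map_has_derivative[OF s1] by (simp add: D2_def)
  have d2: "(D2 z v has_derivative (\<lambda>w. D3 z v w p)) (at p)" for z v p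
    using smooth_map_has_derivative[OF s2] by (simp add: D3_def)
  have sym2: "D2 v w p = D2 w v p" for v w p
    using frechet_derivative_commute[OF u, of v p w] by (simp add: D2_def D1_def[abs_def])
  have sym3: "D3 z v w p = D3 z w v p" for z v w p
    using frechet_derivative_commute[OF s1, of z v p w] by (simp add: D3_def D2_def[abs_def])
  have l1: "linear (\<lambda>v. D1 v p)" for p using d0 has_derivative_linear by blast
  have l2: "linear (\<lambda>v. D2 z v p)" for z p using d1 has_derivative_linear by blast
  have riesz: "l v = (\<Sum>b\<in>Basis. l b *\<^sub>R b) \<bullet> v" if "linear l" for l :: "'a \<Rightarrow> real" and v
  proof -
    have "l v = l (\<Sum>b\<in>Basis. (v \<bullet> b) *\<^sub>R b)" by (simp add: euclidean_representation)
    also have "\<dots> = (\<Sum>b\<in>Basis. (v \<bullet> b) * l b)" using that by (simp add: linear_sum linear_scale)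
    finally show ?thesis by (simp add: inner_sum_left inner_commute[of v] mult.commute)
  qed
  have three: "three_jet u (\<lambda>p. \<Sum>b\<in>Basis. D1 b p *\<^sub>R b) (\<lambda>p v. \<Sum>b\<in>Basis. D2 b v p *\<^sub>R b)
      (\<lambda>p w v. \<Sum>b\<in>Basis. D3 b v w p *\<^sub>R b)"
  proof
    fix p v w y :: 'a
    have gradient: "(\<lambda>v. D1 v p) = (\<bullet>) (\<Sum>b\<in>Basis. D1 b p *\<^sub>R b)"
      by (rule ext) (rule riesz[OF l1])
    show "(u has_derivative (\<bullet>) (\<Sum>b\<in>Basis. D1 b p *\<^sub>R b)) (at p)"
      using d0[of p] unfolding gradient .
    show "((\<lambda>p. \<Sum>b\<in>Basis. D1 b p *\<^sub>R b) has_derivative (\<lambda>v. \<Sum>b\<in>Basis. D2 b v p *\<^sub>R b)) (at p)"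
      by (intro has_derivative_sum has_derivative_scaleR_left d1)
    show "((\<lambda>p. \<Sum>b\<in>Basis. D2 b y p *\<^sub>R b) has_derivative (\<lambda>v. \<Sum>b\<in>Basis. D3 b y v p *\<^sub>R b)) (at p)"
      by (intro has_derivative_sum has_derivative_scaleR_left d2)
    have hess: "(\<Sum>b\<in>Basis. D2 b v p *\<^sub>R b) \<bullet> w = D2 v w p" for v w
      unfolding riesz[OF l2[of v p], of w] by (simp only: sym2[of v])
    show "(\<Sum>b\<in>Basis. D2 b v p *\<^sub>R b) \<bullet> w = (\<Sum>b\<in>Basis. D2 b w p *\<^sub>R b) \<bullet> v"
      unfolding hess by (rule sym2)
    show "(\<Sum>b\<in>Basis. D3 b w v p *\<^sub>R b) = (\<Sum>b\<in>Basis. D3 b v w p *\<^sub>R b)"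
      by (simp add: sym3[of _ v])
  qed
  then show ?thesis by (rule that)
qed

section \<open>Geometry of a vertical graph\<close>

lemma scaleR_double: "(2 * c) *\<^sub>R v = c *\<^sub>R v + c *\<^sub>R (v :: 'a::real_vector)"
  by (simp only: mult_2 scaleR_add_left)

section \<open>Metric duals and the Levi-Civita connection of the warped product\<close>

lemma sharp_eqI:
  assumes "\<And>z. G p v z = \<phi> z" and "\<And>v'. (\<And>z. G p v' z = G p v z) \<Longrightarrow> v' = v"
  shows "sharp G p \<phi> = v"
  unfolding sharp_def by (rule the_equality) (auto simp: assms)

text \<open>Nondegeneracy of the warped metric, whose weight is
  \<open>c = (exp (fst p))\<^sup>2\<close>: vectors along either factor detect the two components
  separately.\<close>

lemma prod_eq_weighted_innerI:
  fixes v w :: "real \<times> 'a::euclidean_space"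
  assumes "\<And>z. fst v * fst z + c * (snd v \<bullet> snd z) = fst w * fst z + c * (snd w \<bullet> snd z)" "c \<noteq> 0"
  shows "v = w"
proof (rule prod_eqI)
  show "fst v = fst w" using assms(1)[of "(1,0)"] by simp
  have "snd v \<bullet> z = snd w \<bullet> z" for z using assms(1)[of "(0,z)"] assms(2) by simp
  then show "snd v = snd w" using vector_eq_rdot by blast
qed

lemma frechet_derivative_warped_metric:
  "frechet_derivative (\<lambda>q. warped_metric q v w) (at p) z
    = 2 * (exp (fst p))\<^sup>2 * fst z * (snd v \<bullet> snd w)"
proof -
  have "((\<lambda>q. warped_metric q v w) has_derivative
      (\<lambda>z. 2 * (exp (fst p))\<^sup>2 * fst z * (snd v \<bullet> snd w))) (at p)"
    unfolding warped_metric_def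
    by (auto intro!: derivative_eq_intros simp: power2_eq_square algebra_simps)
  from fun_cong[OF frechet_derivative_at[OF this]] show ?thesis by simp
qed

lemma christoffel_warped_metric:
  "christoffel warped_metric p v w =
    (- (exp (fst p))\<^sup>2 * (snd v \<bullet> snd w), fst v *\<^sub>R snd w + fst w *\<^sub>R snd v)"
  unfolding christoffel_def
proof (rule sharp_eqI)
  show "v' = v" if "\<And>z. warped_metric p v' z = warped_metric p v z"
    for v v' :: "real \<times> 'a"
    by (rule prod_eq_weighted_innerI[where c="(exp (fst p))\<^sup>2"]) (use that in \<open>auto simp: warped_metric_def\<close>)
qed (unfold frechet_derivative_warped_metric,
    auto simp: warped_metric_def algebra_simps inner_commute)

section \<open>Induced metric, Levi-Civita connection and curvature of the graph\<close>

context three_jet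
begin

text \<open>\<open>met\<close> is the induced metric and \<open>s\<close> the factor in its inverse. Up to scalar factors, \<open>B\<close> is
  the second fundamental form and \<open>C\<close> the shape operator of the graph.\<close>

definition "E p = (exp (u p))\<^sup>2"
definition "s p = 1 / (E p + G p \<bullet> G p)"
definition "B p v = S p v - E p *\<^sub>R v - (2 * (G p \<bullet> v)) *\<^sub>R G p"
definition "C p v = B p v - (s p * (G p \<bullet> B p v)) *\<^sub>R G p"
definition "met p v w = (G p \<bullet> v) * (G p \<bullet> w) + E p * (v \<bullet> w)"

lemma E_pos: "E p > 0" by (simp add: E_def)

lemma s_pos: "s p > 0" by (simp add: s_def E_pos add_pos_nonneg)

lemma s_eq: "s p * (E p + G p \<bullet> G p) = 1"
  using s_pos[of p] by (simp add: s_def)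

lemma linear_S: "linear (S p)" using dG has_derivative_linear by blast

lemma S_add: "S p (v + w) = S p v + S p w" and S_scale: "S p (c *\<^sub>R v) = c *\<^sub>R S p v"
  using linear_S by (auto simp: linear_add linear_scale)

lemma B_sym: "B p v \<bullet> w = B p w \<bullet> v"
  using S_sym[of p v w] by (simp add: B_def inner_simps inner_commute[of w v])

lemma has_derivative_E: "(E has_derivative (\<lambda>v. 2 * E p * (G p \<bullet> v))) (at p)"
  unfolding E_def[abs_def]
  by (auto intro!: derivative_eq_intros du simp: power2_eq_square algebra_simps)

lemma has_derivative_s:
  "(s has_derivative (\<lambda>v. - (s p)\<^sup>2 * (2 * E p * (G p \<bullet> v) + 2 * (S p v \<bullet> G p)))) (at p)"
proof -
  have "E p + G p \<bullet> G p \<noteq> 0" using s_eq[of p] by auto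
  moreover have "((\<lambda>p. E p + G p \<bullet> G p) has_derivative (\<lambda>v. 2 * E p * (G p \<bullet> v) + 2 * (S p v \<bullet> G p))) (at p)"
    by (auto intro!: derivative_eq_intros has_derivative_E dG simp: inner_commute)
  ultimately have "(s has_derivative (\<lambda>v. - ((inverse (E p + G p \<bullet> G p)) *
      (2 * E p * (G p \<bullet> v) + 2 * (S p v \<bullet> G p)) * inverse (E p + G p \<bullet> G p)))) (at p)"
    unfolding s_def[abs_def] divide_inverse mult_1 by (rule Deriv.has_derivative_inverse)
  then show ?thesis by (simp add: s_def power2_eq_square divide_inverse mult_ac)
qed

lemma has_derivative_vertical_graph:
  "(vertical_graph u has_derivative (\<lambda>v. (G p \<bullet> v, v))) (at p)"
  unfolding vertical_graph_def[abs_def] by (auto intro!: derivative_eq_intros du)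

lemma frechet_derivative_vertical_graph: "frechet_derivative (vertical_graph u) (at p) v = (G p \<bullet> v, v)"
  using fun_cong[OF frechet_derivative_at[OF has_derivative_vertical_graph[of p]], of v] by simp

lemma induced_metric_eq: "induced_metric warped_metric (vertical_graph u) = met"
  by (intro ext) (simp add: induced_metric_def warped_metric_def frechet_derivative_vertical_graph met_def
      E_def vertical_graph_def)

text \<open>\<open>met p\<close> has the matrix E I + G G^T, a rank-one perturbation of a multiple
  of the identity, so by the Sherman-Morrison formula its inverse is (I - s G G^T) / E.\<close>

lemma sharp_met:
  assumes "\<And>z. \<phi> z = m \<bullet> z"
  shows "sharp met p \<phi> = (1 / E p) *\<^sub>R (m - (s p * (G p \<bullet> m)) *\<^sub>R G p)" (is "_ = ?v")
proof (rule sharp_eqI)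
  fix z
  have "E p \<noteq> 0" using E_pos[of p] by simp
  have *: "s p * (G p \<bullet> G p) = 1 - s p * E p" using s_eq[of p] by (simp add: algebra_simps)
  have "G p \<bullet> ?v = (1 / E p) * (G p \<bullet> m - (G p \<bullet> m) * (s p * (G p \<bullet> G p)))"
    by (simp add: inner_simps algebra_simps)
  also have "\<dots> = s p * (G p \<bullet> m)" using \<open>E p \<noteq> 0\<close> unfolding * by (simp add: field_simps)
  finally show "met p ?v z = \<phi> z"
    using \<open>E p \<noteq> 0\<close> by (simp add: met_def assms) (simp add: inner_simps field_simps)
next
  fix v v' assume *: "\<And>z. met p v' z = met p v z"
  let ?d = "v' - v"
  have "met p ?d ?d = 0" using *[of ?d] by (simp add: met_def inner_simps algebra_simps)
  then have "(G p \<bullet> ?d)\<^sup>2 + E p * (?d \<bullet> ?d) = 0" by (simp add: met_def power2_eq_square)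
  moreover have "E p * (?d \<bullet> ?d) \<ge> 0" using E_pos[of p] by simp
  ultimately have "E p * (?d \<bullet> ?d) = 0" by (smt (verit) zero_le_power2)
  then show "v' = v" using E_pos[of p] by simp
qed

lemma frechet_derivative_met:
  "frechet_derivative (\<lambda>q. met q v w) (at p) z =
     (S p z \<bullet> v) * (G p \<bullet> w) + (G p \<bullet> v) * (S p z \<bullet> w) + 2 * E p * (G p \<bullet> z) * (v \<bullet> w)"
proof -
  have "((\<lambda>q. met q v w) has_derivative (\<lambda>z.
     (S p z \<bullet> v) * (G p \<bullet> w) + (G p \<bullet> v) * (S p z \<bullet> w) + 2 * E p * (G p \<bullet> z) * (v \<bullet> w))) (at p)"
    unfolding met_def
    by (auto intro!: derivative_eq_intros has_derivative_E dG simp: algebra_simps)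
  from fun_cong[OF frechet_derivative_at[OF this]] show ?thesis by simp
qed

text \<open>The tangential part of the ambient derivative of \<open>(G \<bullet> w, w)\<close> in
  direction \<open>v\<close>: that derivative minus the image of \<open>\<Gamma> p v w\<close> is
  \<open>s p * (B p v \<bullet> w)\<close> times the normal vector
  \<open>(E p, - G p)\<close>.\<close>

definition "\<Gamma> p v w = (G p \<bullet> v) *\<^sub>R w + (G p \<bullet> w) *\<^sub>R v + (s p * (B p v \<bullet> w)) *\<^sub>R G p"

lemma christoffel_met: "christoffel met p v w = \<Gamma> p v w"
proof -
  let ?b = "B p v \<bullet> w"
  \<comment> \<open>The Euclidean dual of the Koszul form. Raising its index divides by
    \<open>E p\<close> and otherwise alters only the coefficient of \<open>G p\<close>, which
    \<open>s_eq\<close> reduces to \<open>s p * ?b\<close>.\<close>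
  define m where "m = (S p v \<bullet> w) *\<^sub>R G p + E p *\<^sub>R
     ((G p \<bullet> v) *\<^sub>R w + (G p \<bullet> w) *\<^sub>R v - (v \<bullet> w) *\<^sub>R G p)"
  have "christoffel met p v w = (1 / E p) *\<^sub>R (m - (s p * (G p \<bullet> m)) *\<^sub>R G p)"
    unfolding christoffel_def
  proof (rule sharp_met)
    fix z show "(frechet_derivative (\<lambda>q. met q w z) (at p) v + frechet_derivative (\<lambda>q. met q v z) (at p) w
        - frechet_derivative (\<lambda>q. met q v w) (at p) z) / 2 = m \<bullet> z"
      using S_sym[of p v w] S_sym[of p v z] S_sym[of p w z]
      by (simp add: frechet_derivative_met m_def inner_simps field_simps inner_commute)
  qed
  moreover have "m = E p *\<^sub>R ((G p \<bullet> v) *\<^sub>R w + (G p \<bullet> w) *\<^sub>R v)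
     + (?b + 2 * (G p \<bullet> v) * (G p \<bullet> w)) *\<^sub>R G p"
    by (simp add: m_def B_def inner_simps algebra_simps)
  moreover have "(?b + 2 * (G p \<bullet> v) * (G p \<bullet> w)) - s p * (G p \<bullet> m) = E p * (s p * ?b)"
  proof -
    have gm: "G p \<bullet> m = 2 * E p * (G p \<bullet> v) * (G p \<bullet> w) + (?b + 2 * (G p \<bullet> v) * (G p \<bullet> w)) * (G p \<bullet> G p)"
      by (simp add: m_def B_def inner_simps algebra_simps)
    show ?thesis unfolding gm using s_eq[of p] by algebra
  qed
  moreover have "E p \<noteq> 0" using E_pos[of p] by simp
  ultimately show ?thesis
  proof -
    let ?k = "?b + 2 * (G p \<bullet> v) * (G p \<bullet> w)"
    assume 1: "christoffel met p v w = (1 / E p) *\<^sub>R (m - (s p * (G p \<bullet> m)) *\<^sub>R G p)"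
      and 2: "m = E p *\<^sub>R ((G p \<bullet> v) *\<^sub>R w + (G p \<bullet> w) *\<^sub>R v) + ?k *\<^sub>R G p"
      and 3: "?k - s p * (G p \<bullet> m) = E p * (s p * ?b)" and 4: "E p \<noteq> 0"
    have "m - (s p * (G p \<bullet> m)) *\<^sub>R G p
       = E p *\<^sub>R ((G p \<bullet> v) *\<^sub>R w + (G p \<bullet> w) *\<^sub>R v) + (?k - s p * (G p \<bullet> m)) *\<^sub>R G p"
      by (subst (1) 2) (simp only: scaleR_left_diff_distrib add_diff_eq)
    also have "\<dots> = E p *\<^sub>R \<Gamma> p v w" unfolding 3 \<Gamma>_def by (simp add: scaleR_add_right)
    finally show ?thesis unfolding 1 using 4 by simp
  qed
qed

lemma has_derivative_\<Gamma>:
  "((\<lambda>p. \<Gamma> p y z) has_derivative (\<lambda>x. (S p x \<bullet> y) *\<^sub>R z + (S p x \<bullet> z) *\<^sub>R y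
     + (s p * (B p y \<bullet> z)) *\<^sub>R S p x
     + (- (s p)\<^sup>2 * (2 * E p * (G p \<bullet> x) + 2 * (S p x \<bullet> G p)) * (B p y \<bullet> z)
        + s p * (T p x y \<bullet> z - 2 * E p * (G p \<bullet> x) * (y \<bullet> z)
          - 2 * (S p x \<bullet> y) * (G p \<bullet> z) - 2 * (G p \<bullet> y) * (S p x \<bullet> z))) *\<^sub>R G p)) (at p)"
proof -
  have "((\<lambda>p. B p y \<bullet> z) has_derivative (\<lambda>x. T p x y \<bullet> z - 2 * E p * (G p \<bullet> x) * (y \<bullet> z)
          - 2 * (S p x \<bullet> y) * (G p \<bullet> z) - 2 * (G p \<bullet> y) * (S p x \<bullet> z))) (at p)"
    unfolding B_def
    by (auto intro!: derivative_eq_intros has_derivative_E dG dS simp: inner_simps algebra_simps)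
  note has_derivative_mult[OF has_derivative_s this]
  note has_derivative_scaleR[OF this dG]
  moreover have "((\<lambda>p. (G p \<bullet> y) *\<^sub>R z + (G p \<bullet> z) *\<^sub>R y) has_derivative
      (\<lambda>x. (S p x \<bullet> y) *\<^sub>R z + (S p x \<bullet> z) *\<^sub>R y)) (at p)"
    by (auto intro!: derivative_eq_intros dG)
  ultimately show ?thesis
    unfolding \<Gamma>_def
    by (rule has_derivative_eq_rhs[OF has_derivative_add[rotated]]) (simp add: fun_eq_iff algebra_simps)
qed

text \<open>The Gauss equation for ambient curvature -1, by direct expansion: both sides are
  compared as combinations of \<open>x\<close>, \<open>y\<close>, \<open>z\<close>,
  \<open>S p x\<close>, \<open>S p y\<close> and \<open>G p\<close>, and the third derivatives in
  \<open>T\<close> drop out on antisymmetrising in \<open>x\<close> and \<open>y\<close>.\<close>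

lemma gauss_equation:
  "curvature met p x y z = met p x z *\<^sub>R y - met p y z *\<^sub>R x
     + (s p * (B p y \<bullet> z)) *\<^sub>R C p x - (s p * (B p x \<bullet> z)) *\<^sub>R C p y"
proof -
  have c: "cov met (\<lambda>q. cov met (\<lambda>_. z) q y) p x =
     frechet_derivative (\<lambda>q. \<Gamma> q y z) (at p) x + \<Gamma> p x (\<Gamma> p y z)" for x y
    by (simp add: cov_def christoffel_met)
  define \<beta> where "\<beta> v = s p * (B p v \<bullet> z)" for v
  \<comment> \<open>\<open>D\<close> and, below, \<open>Q\<close> collect the coefficients of
    \<open>G p\<close> in the derivative of \<open>\<Gamma>\<close> and in the iterated
    \<open>\<Gamma>\<close>.\<close>
  define D where "D x y = - 2 * s p * (E p * (G p \<bullet> x) + S p x \<bullet> G p) * \<beta> y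
        + s p * (T p x y \<bullet> z - 2 * E p * (G p \<bullet> x) * (y \<bullet> z)
          - 2 * (S p x \<bullet> y) * (G p \<bullet> z) - 2 * (G p \<bullet> y) * (S p x \<bullet> z))" for x y
  have fd: "frechet_derivative (\<lambda>q. \<Gamma> q y z) (at p) x =
     (S p x \<bullet> y) *\<^sub>R z + (S p x \<bullet> z) *\<^sub>R y + \<beta> y *\<^sub>R S p x + D x y *\<^sub>R G p" for x y
    using frechet_derivative_at[OF has_derivative_\<Gamma>[of y z p]]
    by (simp add: fun_eq_iff D_def \<beta>_def power2_eq_square algebra_simps)
  define Q where "Q x y = (G p \<bullet> x) * \<beta> y + s p * ((G p \<bullet> y) * (B p x \<bullet> z)
      + (G p \<bullet> z) * (B p x \<bullet> y) + \<beta> y * (B p x \<bullet> G p))" for x y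
  have gg: "\<Gamma> p x (\<Gamma> p y z) = ((G p \<bullet> x) * (G p \<bullet> y)) *\<^sub>R z + ((G p \<bullet> x) * (G p \<bullet> z)) *\<^sub>R y
     + (2 * (G p \<bullet> y) * (G p \<bullet> z) + \<beta> y * (G p \<bullet> G p)) *\<^sub>R x + Q x y *\<^sub>R G p" for x y
    by (simp add: \<Gamma>_def Q_def \<beta>_def inner_simps algebra_simps)
  have Byz: "(E p + G p \<bullet> G p) * \<beta> v = S p v \<bullet> z - E p * (v \<bullet> z) - 2 * (G p \<bullet> v) * (G p \<bullet> z)" for v
    using s_eq[of p] unfolding \<beta>_def by (simp add: B_def inner_simps) algebra
  have Cx: "C p v = S p v - E p *\<^sub>R v - (2 * (G p \<bullet> v) + s p * (G p \<bullet> B p v)) *\<^sub>R G p" for v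
    by (simp add: C_def B_def algebra_simps)
  have cy: "(S p x \<bullet> z) - (G p \<bullet> x) * (G p \<bullet> z) - \<beta> x * (G p \<bullet> G p) = met p x z + E p * \<beta> x" for x
    using Byz[of x] by (simp add: met_def algebra_simps)
  \<comment> \<open>The antisymmetrised coefficient of \<open>G p\<close> has to be the rank-one
    correction by which \<open>C p v\<close> differs from
    \<open>S p v - E p *\<^sub>R v\<close>.\<close>
  have cG: "D x y + Q x y - D y x - Q y x =
     - \<beta> y * (2 * (G p \<bullet> x) + s p * (G p \<bullet> B p x)) + \<beta> x * (2 * (G p \<bullet> y) + s p * (G p \<bullet> B p y))"
  proof -
    have t: "T p x y \<bullet> z = T p y x \<bullet> z" by (simp add: T_sym[of p x y])
    have sy: "S p x \<bullet> y = S p y \<bullet> x" "B p x \<bullet> y = B p y \<bullet> x" by (rule S_sym, rule B_sym)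
    have gb: "G p \<bullet> B p v = S p v \<bullet> G p - E p * (G p \<bullet> v) - 2 * (G p \<bullet> v) * (G p \<bullet> G p)" 
             "B p v \<bullet> G p = S p v \<bullet> G p - E p * (G p \<bullet> v) - 2 * (G p \<bullet> v) * (G p \<bullet> G p)" for v
      by (simp_all add: B_def inner_simps inner_commute)
    have bb: "B p v \<bullet> z = S p v \<bullet> z - E p * (v \<bullet> z) - 2 * (G p \<bullet> v) * (G p \<bullet> z)" for v
      by (simp add: B_def inner_simps)
    have DD: "D x y - D y x = - 2 * s p * (E p * (G p \<bullet> x) + S p x \<bullet> G p) * \<beta> y
        + 2 * s p * (E p * (G p \<bullet> y) + S p y \<bullet> G p) * \<beta> x + 2 * ((G p \<bullet> x) * \<beta> y - (G p \<bullet> y) * \<beta> x)"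
      unfolding D_def \<beta>_def bb t sy by (simp add: algebra_simps)
    have QQ: "Q x y - Q y x = s p * (\<beta> y * (G p \<bullet> B p x) - \<beta> x * (G p \<bullet> B p y))"
      unfolding Q_def \<beta>_def sy by (simp add: algebra_simps inner_commute)
    have k: "2 * s p * (G p \<bullet> B p v) - 2 * s p * (E p * (G p \<bullet> v) + S p v \<bullet> G p) + 4 * (G p \<bullet> v) = 0" for v
      unfolding gb(1) using s_eq[of p] by algebra
    have "D x y + Q x y - D y x - Q y x
       + \<beta> y * (2 * (G p \<bullet> x) + s p * (G p \<bullet> B p x)) - \<beta> x * (2 * (G p \<bullet> y) + s p * (G p \<bullet> B p y))
       = \<beta> y * (2 * s p * (G p \<bullet> B p x) - 2 * s p * (E p * (G p \<bullet> x) + S p x \<bullet> G p) + 4 * (G p \<bullet> x))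
       - \<beta> x * (2 * s p * (G p \<bullet> B p y) - 2 * s p * (E p * (G p \<bullet> y) + S p y \<bullet> G p) + 4 * (G p \<bullet> y))"
      using DD QQ by (simp add: algebra_simps)
    then show ?thesis unfolding k by simp
  qed
  \<comment> \<open>The terms \<open>E p * \<beta> x\<close> and \<open>E p * \<beta> y\<close>
    produced by \<open>cy\<close> complete \<open>S p y\<close> and \<open>S p x\<close> to
    \<open>C p y\<close> and \<open>C p x\<close>, so that only \<open>met\<close> is left
    over.\<close>
  have "curvature met p x y z =
     ((S p x \<bullet> z) - (G p \<bullet> x) * (G p \<bullet> z) - \<beta> x * (G p \<bullet> G p)) *\<^sub>R y
     - ((S p y \<bullet> z) - (G p \<bullet> y) * (G p \<bullet> z) - \<beta> y * (G p \<bullet> G p)) *\<^sub>R x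
     + \<beta> y *\<^sub>R S p x - \<beta> x *\<^sub>R S p y + (D x y + Q x y - D y x - Q y x) *\<^sub>R G p"
    unfolding curvature_def c fd gg by (simp add: S_sym[of p y x] scaleR_double algebra_simps)
  then show ?thesis
    unfolding cy cG Cx \<beta>_def[symmetric] by (simp add: algebra_simps)
qed

lemma C_inner: "B p v \<bullet> C p w = B p (C p w) \<bullet> v"
  using B_sym[of p v "C p w"] by simp

text \<open>The trace of the Gauss equation over \<open>x\<close>, put in the form of a Euclidean
  product with \<open>z\<close> to which \<open>sharp_met\<close> applies.\<close>

lemma ricci_met:
  "ricci met p y z = (- (real DIM('a) - 1) *\<^sub>R (E p *\<^sub>R y + (G p \<bullet> y) *\<^sub>R G p)
     + (s p * trace_op (C p)) *\<^sub>R B p y - s p *\<^sub>R B p (C p y)) \<bullet> z"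
proof -
  have l: "(\<Sum>b\<in>Basis. c * (v \<bullet> b) * (w \<bullet> b)) = c * (v \<bullet> w)" for c and v w :: 'a
    by (simp add: euclidean_inner[of v w] sum_distrib_left mult.assoc)
  have Bz: "b \<bullet> B p z = z \<bullet> B p b" for b
    using B_sym[of p z b] by (simp add: inner_commute)
  have "ricci met p y z = (\<Sum>b\<in>Basis. (met p b z *\<^sub>R y - met p y z *\<^sub>R b
     + (s p * (B p y \<bullet> z)) *\<^sub>R C p b - (s p * (B p b \<bullet> z)) *\<^sub>R C p y) \<bullet> b)"
    by (simp add: ricci_def trace_op_def gauss_equation)
  also have "\<dots> = (\<Sum>b\<in>Basis. (G p \<bullet> z) * (G p \<bullet> b) * (y \<bullet> b) + E p * (z \<bullet> b) * (y \<bullet> b)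
     - met p y z + (s p * (B p y \<bullet> z)) * (C p b \<bullet> b) - s p * (B p z \<bullet> b) * (C p y \<bullet> b))"
    by (rule sum.cong) (auto simp: met_def inner_simps inner_commute Bz algebra_simps)
  also have "\<dots> = (G p \<bullet> z) * (G p \<bullet> y) + E p * (z \<bullet> y) - real DIM('a) * met p y z
     + (s p * (B p y \<bullet> z)) * trace_op (C p) - s p * (B p z \<bullet> C p y)"
    by (simp only: sum.distrib sum_subtractf l sum_constant trace_op_def sum_distrib_left)
  finally show ?thesis
    by (simp add: C_inner met_def inner_simps algebra_simps inner_commute)
qed

lemma scalar_curvature_met:
  "scalar_curvature met p = - real DIM('a) * (real DIM('a) - 1)
     + s p / E p * ((trace_op (C p))\<^sup>2 - trace_op (\<lambda>v. C p (C p v)))"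
proof -
  let ?n = "real DIM('a)"
  have E: "E p \<noteq> 0" using E_pos[of p] by simp
  have sharp0: "sharp met p (ricci met p v) = - (?n - 1) *\<^sub>R v
     + (s p / E p * trace_op (C p)) *\<^sub>R C p v - (s p / E p) *\<^sub>R C p (C p v)" for v
  proof -
    \<comment> \<open>\<open>?r\<close> is \<open>E p\<close> times the inverse metric: it sends the
      Euclidean dual of \<open>met p v\<close> to \<open>E p *\<^sub>R v\<close> and
      \<open>B p v\<close> to \<open>C p v\<close>.\<close>
    let ?r = "\<lambda>w. w - (s p * (G p \<bullet> w)) *\<^sub>R G p"
    have lin: "?r (a *\<^sub>R x + b *\<^sub>R y - c *\<^sub>R z) = a *\<^sub>R ?r x + b *\<^sub>R ?r y - c *\<^sub>R ?r z" for a b c x y z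
      by (simp add: inner_simps algebra_simps)
    have r1: "?r (E p *\<^sub>R v + (G p \<bullet> v) *\<^sub>R G p) = E p *\<^sub>R v"
    proof -
      have "(G p \<bullet> v) - s p * (G p \<bullet> (E p *\<^sub>R v + (G p \<bullet> v) *\<^sub>R G p)) = 0"
        using s_eq[of p] by (simp add: inner_simps) algebra
      then have "(G p \<bullet> v) *\<^sub>R G p = (s p * (G p \<bullet> (E p *\<^sub>R v + (G p \<bullet> v) *\<^sub>R G p))) *\<^sub>R G p"
        by simp
      then show ?thesis by simp
    qed
    have "sharp met p (ricci met p v) = (1 / E p) *\<^sub>R ?r (- (?n - 1) *\<^sub>R (E p *\<^sub>R v + (G p \<bullet> v) *\<^sub>R G p)
       + (s p * trace_op (C p)) *\<^sub>R B p v - s p *\<^sub>R B p (C p v))"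
      by (rule sharp_met) (rule ricci_met)
    also have "\<dots> = (1 / E p) *\<^sub>R (- (?n - 1) *\<^sub>R (E p *\<^sub>R v)
       + (s p * trace_op (C p)) *\<^sub>R C p v - s p *\<^sub>R C p (C p v))"
      unfolding lin r1 C_def[symmetric] by simp
    finally show ?thesis using E by (simp add: algebra_simps)
  qed
  define \<tau> where "\<tau> = trace_op (C p)"
  note sharp = sharp0[folded \<tau>_def]
  have "scalar_curvature met p = (\<Sum>b\<in>Basis. - (?n - 1)
     + s p / E p * \<tau> * (C p b \<bullet> b) - s p / E p * (C p (C p b) \<bullet> b))"
    unfolding scalar_curvature_def sharp by (simp add: trace_op_def inner_simps)
  also have "\<dots> = ?n * (- (?n - 1)) + s p / E p * \<tau> * trace_op (C p)
     - s p / E p * trace_op (\<lambda>v. C p (C p v))"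
    by (simp only: sum.distrib sum_subtractf sum_constant trace_op_def sum_distrib_left)
  finally show ?thesis by (simp add: power2_eq_square \<tau>_def algebra_simps)
qed

lemma C_eq: "C p v = S p v - E p *\<^sub>R v - (s p * (E p * (G p \<bullet> v) + S p v \<bullet> G p)) *\<^sub>R G p"
proof -
  have "2 * (G p \<bullet> v) + s p * (G p \<bullet> B p v) = s p * (E p * (G p \<bullet> v) + S p v \<bullet> G p)"
    using s_eq[of p] by (simp add: B_def inner_simps inner_commute[of "G p" "S p v"]) algebra
  moreover have "C p v = S p v - E p *\<^sub>R v - (2 * (G p \<bullet> v) + s p * (G p \<bullet> B p v)) *\<^sub>R G p"
    by (simp add: C_def B_def algebra_simps)
  ultimately show ?thesis by simp
qed

end

section \<open>Unit normal, shape operator and mean curvature of the graph\<close>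

locale normal_graph = three_jet u G S T
  for u :: "'a::euclidean_space \<Rightarrow> real" and G S T +
  fixes N :: "'a \<Rightarrow> real \<times> 'a"
  assumes normal: "unit_normal_field warped_metric (vertical_graph u) N"
    and downward: "fst (N p) < 0"
begin

abbreviation "\<theta> p \<equiv> fst (N p)"

text \<open>Orthogonality to every tangent vector \<open>(G p \<bullet> v, v)\<close> determines the
  horizontal part of \<open>N\<close> from the vertical part \<open>\<theta>\<close>, which is the
  metric product of \<open>N\<close> with \<open>d_t\<close>.\<close>

lemma snd_N: "snd (N p) = - (\<theta> p / E p) *\<^sub>R G p"
proof -
  have "\<theta> p * (G p \<bullet> v) + E p * (snd (N p) \<bullet> v) = 0" for v
    using normal by (simp add: unit_normal_field_def frechet_derivative_vertical_graph warped_metric_def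
        vertical_graph_def E_def)
  then have "(\<theta> p *\<^sub>R G p + E p *\<^sub>R snd (N p)) \<bullet> v = 0" for v
    by (simp add: inner_simps)
  then have "\<theta> p *\<^sub>R G p + E p *\<^sub>R snd (N p) = 0"
    using inner_eq_zero_iff by blast
  then have "(1 / E p) *\<^sub>R (\<theta> p *\<^sub>R G p + E p *\<^sub>R snd (N p)) = 0" by simp
  then have "(\<theta> p / E p) *\<^sub>R G p + snd (N p) = 0"
    using E_pos[of p] by (simp add: scaleR_add_right)
  then show ?thesis by (simp add: eq_neg_iff_add_eq_0 add.commute)
qed

lemma \<theta>_square: "(\<theta> p)\<^sup>2 = E p * s p"
proof -
  have "\<theta> p * \<theta> p + E p * (snd (N p) \<bullet> snd (N p)) = 1"
    using normal by (simp add: unit_normal_field_def warped_metric_def vertical_graph_def E_def)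
  then have "\<theta> p * \<theta> p * (E p + G p \<bullet> G p) = E p"
    unfolding snd_N using E_pos[of p] by (simp add: field_simps)
  then have "s p * (\<theta> p * \<theta> p * (E p + G p \<bullet> G p)) = s p * E p" by simp
  then have "\<theta> p * \<theta> p * (s p * (E p + G p \<bullet> G p)) = s p * E p" by (simp only: mult_ac)
  then show ?thesis by (simp add: s_eq power2_eq_square mult.commute)
qed

text \<open>So far only the square of \<open>\<theta>\<close> is known in closed form; the identity
  \<open>\<theta>_square\<close> is therefore differentiated and divided by
  \<open>2 * \<theta> p\<close>, which is nonzero by \<open>downward\<close>.\<close>

lemma has_derivative_\<theta>:
  "(\<theta> has_derivative (\<lambda>v. \<theta> p * ((G p \<bullet> v) - s p * (E p * (G p \<bullet> v) + S p v \<bullet> G p)))) (at p)"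
proof -
  have "(N has_derivative frechet_derivative N (at p)) (at p)"
    using normal by (intro smooth_map_has_derivative) (simp add: unit_normal_field_def)
  from has_derivative_fst[OF this]
  have d: "(\<theta> has_derivative (\<lambda>v. fst (frechet_derivative N (at p) v))) (at p)" (is "(_ has_derivative ?d) _") .
  have sq: "((\<lambda>p. \<theta> p * \<theta> p) has_derivative (\<lambda>v. \<theta> p * ?d v + ?d v * \<theta> p)) (at p)"
    by (rule has_derivative_mult[OF d d])
  have eq: "(\<lambda>p. \<theta> p * \<theta> p) = (\<lambda>p. E p * s p)"
    using \<theta>_square by (simp add: fun_eq_iff power2_eq_square)
  have Es: "((\<lambda>p. E p * s p) has_derivative (\<lambda>v. E p * (- (s p)\<^sup>2 * (2 * E p * (G p \<bullet> v) + 2 * (S p v \<bullet> G p)))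
      + 2 * E p * (G p \<bullet> v) * s p)) (at p)"
    by (rule has_derivative_mult[OF has_derivative_E has_derivative_s])
  have "(\<lambda>v. \<theta> p * ?d v + ?d v * \<theta> p) =
      (\<lambda>v. E p * (- (s p)\<^sup>2 * (2 * E p * (G p \<bullet> v) + 2 * (S p v \<bullet> G p))) + 2 * E p * (G p \<bullet> v) * s p)"
    by (rule has_derivative_unique[OF sq[unfolded eq] Es])
  then have e: "2 * (\<theta> p * ?d v) = 2 * (E p * s p) * ((G p \<bullet> v) - s p * (E p * (G p \<bullet> v) + S p v \<bullet> G p))" for v
    by (simp add: fun_eq_iff power2_eq_square algebra_simps)
  have "?d v = \<theta> p * ((G p \<bullet> v) - s p * (E p * (G p \<bullet> v) + S p v \<bullet> G p))" for v
    using e[of v, folded \<theta>_square] downward[of p] by (simp add: power2_eq_square)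
  with d show ?thesis by simp
qed

text \<open>The horizontal component of a tangent vector is its coordinate vector. So the result is
  read off the horizontal component, and the vertical one is checked to be its product with
  \<open>G p\<close>, as tangency demands.\<close>

lemma cov_along_N:
  "cov_along warped_metric (vertical_graph u) N p v =
    - frechet_derivative (vertical_graph u) (at p) ((\<theta> p / E p) *\<^sub>R C p v)"
proof -
  \<comment> \<open>The logarithmic derivative of \<open>\<theta>\<close> in direction
    \<open>v\<close>.\<close>
  define k where "k = (G p \<bullet> v) - s p * (E p * (G p \<bullet> v) + S p v \<bullet> G p)"
  have E: "E p \<noteq> 0" using E_pos[of p] by simp
  have "((\<lambda>p. (\<theta> p, - (\<theta> p / E p) *\<^sub>R G p)) has_derivative (\<lambda>v. (\<theta> p * ((G p \<bullet> v) - s p * (E p * (G p \<bullet> v) + S p v \<bullet> G p)),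
     - (\<theta> p / E p) *\<^sub>R S p v
     + - ((- \<theta> p * (inverse (E p) * (2 * E p * (G p \<bullet> v)) * inverse (E p)) +
          \<theta> p * ((G p \<bullet> v) - s p * (E p * (G p \<bullet> v) + S p v \<bullet> G p)) / E p)) *\<^sub>R G p))) (at p)"
    by (intro has_derivative_Pair has_derivative_scaleR has_derivative_minus
        has_derivative_divide has_derivative_\<theta> has_derivative_E dG E)
  moreover have "(\<lambda>p. (\<theta> p, - (\<theta> p / E p) *\<^sub>R G p)) = N"
    by (simp add: fun_eq_iff prod_eq_iff snd_N)
  ultimately have "frechet_derivative N (at p) v = (\<theta> p * k,
     - (\<theta> p / E p) *\<^sub>R S p v
     + - ((- \<theta> p * (inverse (E p) * (2 * E p * (G p \<bullet> v)) * inverse (E p)) + \<theta> p * k / E p)) *\<^sub>R G p)"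
    using fun_cong[OF frechet_derivative_at, of N _ p v] by (simp add: k_def)
  also have "\<dots> = (\<theta> p * k, - (\<theta> p / E p) *\<^sub>R (S p v - (2 * (G p \<bullet> v) - k) *\<^sub>R G p))"
    using E by (simp add: algebra_simps divide_inverse)
  finally have DN: "frechet_derivative N (at p) v = (\<theta> p * k, - (\<theta> p / E p) *\<^sub>R (S p v - (2 * (G p \<bullet> v) - k) *\<^sub>R G p))" .
  have "cov_along warped_metric (vertical_graph u) N p v =
     (\<theta> p * k + \<theta> p * (G p \<bullet> v), - (\<theta> p / E p) *\<^sub>R (S p v - E p *\<^sub>R v - ((G p \<bullet> v) - k) *\<^sub>R G p))"
    using E unfolding cov_along_def christoffel_warped_metric frechet_derivative_vertical_graph snd_N DN
    by (simp add: scaleR_double diff_divide_distrib vertical_graph_def E_def[symmetric] inner_commute[of v] algebra_simps)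
  moreover have "C p v = S p v - E p *\<^sub>R v - ((G p \<bullet> v) - k) *\<^sub>R G p"
    by (simp add: C_eq k_def)
  moreover have "- (\<theta> p / E p) * (G p \<bullet> C p v) = \<theta> p * k + \<theta> p * (G p \<bullet> v)"
  proof -
    have "- (G p \<bullet> C p v) = E p * (k + (G p \<bullet> v))"
      using s_eq[of p] unfolding C_eq k_def
      by (simp add: inner_simps inner_commute[of "S p v"]) algebra
    then have "\<theta> p / E p * (- (G p \<bullet> C p v)) = \<theta> p / E p * (E p * (k + (G p \<bullet> v)))" by simp
    then show ?thesis using E by (simp add: algebra_simps)
  qed
  ultimately show ?thesis by (simp add: frechet_derivative_vertical_graph)
qed

lemma shape_operator_eq:
  "shape_operator warped_metric (vertical_graph u) N p v = (\<theta> p / E p) *\<^sub>R C p v"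
  unfolding shape_operator_def cov_along_N
  by (rule the_equality) (auto simp: frechet_derivative_vertical_graph)

lemma mean_curvature_eq:
  "real DIM('a) * mean_curvature warped_metric (vertical_graph u) N p = \<theta> p / E p * trace_op (C p)"
  proof -
  have "trace_op (\<lambda>v. (\<theta> p / E p) *\<^sub>R C p v) = \<theta> p / E p * trace_op (C p)"
    by (simp add: trace_op_def sum_distrib_left)
  then show ?thesis by (simp add: mean_curvature_def shape_operator_eq[abs_def])
qed

end

section \<open>Traces of products of self-adjoint operators\<close>

locale selfadjoint_pair =
  fixes P :: "'a::euclidean_space \<Rightarrow> 'a" and d :: 'a
  assumes linear_P: "linear P" and P_sym: "P v \<bullet> w = P w \<bullet> v"
begin

text \<open>\<open>K\<close> is the inverse of I + d d^T, the first fundamental form of a Euclidean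
  graph with gradient \<open>d\<close>; \<open>W\<close> is the area element of that graph.\<close>

definition "W = sqrt (1 + d \<bullet> d)"
definition "K v = v - ((d \<bullet> v) / W\<^sup>2) *\<^sub>R d"

lemma W_square: "W\<^sup>2 = 1 + d \<bullet> d" by (simp add: W_def)

lemma W_ge_1: "W \<ge> 1" by (simp add: W_def)

lemma P_diff: "P (v - w) = P v - P w" and P_add: "P (v + w) = P v + P w"
  and P_scale: "P (c *\<^sub>R v) = c *\<^sub>R P v"
  using linear_P by (auto simp: linear_diff linear_scale linear_add)

lemma trace_KP: "trace_op (\<lambda>v. K (P v)) = trace_op P - (P d \<bullet> d) / W\<^sup>2"
proof -
  have "trace_op (\<lambda>v. K (P v)) = (\<Sum>b\<in>Basis. P b \<bullet> b - 1 / W\<^sup>2 * ((P d \<bullet> b) * (d \<bullet> b)))"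
    by (simp add: trace_op_def K_def inner_simps inner_commute[of d "P _"] P_sym[of _ d])
  also have "\<dots> = trace_op P - 1 / W\<^sup>2 * (P d \<bullet> d)"
    by (simp only: sum_subtractf euclidean_inner[symmetric] trace_op_def sum_distrib_left[symmetric])
  finally show ?thesis by simp
qed

lemma trace_KPKP:
  "trace_op (\<lambda>v. K (P (K (P v)))) =
    (\<Sum>b\<in>Basis. P b \<bullet> P b) - 2 / W\<^sup>2 * (P d \<bullet> P d) + ((P d \<bullet> d) / W\<^sup>2)\<^sup>2"
proof -
  define k where "k = 1 / W\<^sup>2"
  have K: "K v = v - (k * (d \<bullet> v)) *\<^sub>R d" for v by (simp add: K_def k_def)
  have "K (P (K (P b))) \<bullet> b = P b \<bullet> P b - k * ((P d \<bullet> b) * (P d \<bullet> b))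
     - k * ((P (P d) \<bullet> b) * (d \<bullet> b)) + k * k * (P d \<bullet> d) * ((P d \<bullet> b) * (d \<bullet> b))" for b
  proof -
    have dP: "d \<bullet> P v = P d \<bullet> v" for v
      using P_sym[of v d] by (simp add: inner_commute)
    have KP: "K (P v) = P v - (k * (P d \<bullet> v)) *\<^sub>R d" for v
      unfolding K dP ..
    have "P (P d) \<bullet> b = P d \<bullet> P b" using P_sym[of "P d" b] by (simp add: inner_commute)
    moreover have "P (P b) \<bullet> b = P b \<bullet> P b" by (rule P_sym)
    ultimately show ?thesis
      unfolding KP P_diff P_scale by (simp add: K dP inner_diff_left inner_diff_right algebra_simps)
  qed
  then have "trace_op (\<lambda>v. K (P (K (P v)))) = (\<Sum>b\<in>Basis. P b \<bullet> P b - k * ((P d \<bullet> b) * (P d \<bullet> b))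
     - k * ((P (P d) \<bullet> b) * (d \<bullet> b)) + k * k * (P d \<bullet> d) * ((P d \<bullet> b) * (d \<bullet> b)))"
    by (simp add: trace_op_def)
  also have "\<dots> = (\<Sum>b\<in>Basis. P b \<bullet> P b) - k * (P d \<bullet> P d) - k * (P (P d) \<bullet> d) + k * k * (P d \<bullet> d) * (P d \<bullet> d)"
    by (simp only: sum.distrib sum_subtractf sum_distrib_left[symmetric] euclidean_inner[symmetric])
  also have "P (P d) \<bullet> d = P d \<bullet> P d" using P_sym by blast
  finally show ?thesis by (simp add: k_def power2_eq_square algebra_simps)
qed

text \<open>By Cauchy-Schwarz and \<open>d \<bullet> d \<le> W\<^sup>2\<close>, the square in
  \<open>trace_KPKP\<close> is at most \<open>(P d \<bullet> P d) / W\<^sup>2\<close>, half of what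
  the negative term subtracts.\<close>

lemma trace_KPKP_le: "trace_op (\<lambda>v. K (P (K (P v)))) \<le> (\<Sum>b\<in>Basis. P b \<bullet> P b)"
proof -
  have W: "W\<^sup>2 > 0" using W_ge_1 by simp
  have "(P d \<bullet> d)\<^sup>2 \<le> (P d \<bullet> P d) * (d \<bullet> d)" by (rule Cauchy_Schwarz_ineq)
  also have "\<dots> \<le> (P d \<bullet> P d) * W\<^sup>2" by (intro mult_left_mono) (auto simp: W_square)
  finally have "((P d \<bullet> d) / W\<^sup>2)\<^sup>2 \<le> (P d \<bullet> P d) * W\<^sup>2 / (W\<^sup>2)\<^sup>2"
    by (simp add: power_divide divide_right_mono)
  also have "\<dots> = (P d \<bullet> P d) / W\<^sup>2" using W by (simp add: power2_eq_square)
  also have "\<dots> \<le> 2 / W\<^sup>2 * (P d \<bullet> P d)" using W by (simp add: field_simps)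
  finally show ?thesis unfolding trace_KPKP by linarith
qed

text \<open>\<open>K\<close> is the square of \<open>L v = v - \<kappa> (d \<bullet> v) d\<close>, so \<open>K P\<close> has the traces of the self-adjoint
  operator \<open>L P L\<close>.\<close>

lemma trace_KP_square_le:
  "(trace_op (\<lambda>v. K (P v)))\<^sup>2 \<le> real DIM('a) * trace_op (\<lambda>v. K (P (K (P v))))"
proof -
  define k where "k = 1 / W\<^sup>2"
  \<comment> \<open>The root of
    \<open>\<kappa> * (2 - \<kappa> * (d \<bullet> d)) = 1 / W\<^sup>2\<close> that stays finite as
    \<open>d\<close> tends to 0; it gives \<open>L\<close> the factor \<open>1 / W\<close> on
    \<open>d\<close>, making \<open>L\<close> the positive square root of \<open>K\<close>.\<close>
  define \<kappa> where "\<kappa> = 1 / (W * (W + 1))"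
  define L where "L v = v - (\<kappa> * (d \<bullet> v)) *\<^sub>R d" for v
  have W: "W > 0" "W + 1 > 0" using W_ge_1 by auto
  have dd: "d \<bullet> d = (W - 1) * (W + 1)" using W_square by (simp add: power2_eq_square algebra_simps)
  have "\<kappa> * (d \<bullet> d) = (W - 1) / W" unfolding \<kappa>_def dd using W by simp
  then have "2 - \<kappa> * (d \<bullet> d) = (W + 1) / W" using W by (simp add: field_simps)
  then have \<kappa>: "\<kappa> * (2 - \<kappa> * (d \<bullet> d)) = k"
    using W by (simp add: \<kappa>_def k_def power2_eq_square)
  have dP: "d \<bullet> P v = P d \<bullet> v" for v
    using P_sym[of v d] by (simp add: inner_commute)
  have LL: "L v \<bullet> L v = v \<bullet> v - k * (d \<bullet> v)\<^sup>2" for v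
    unfolding \<kappa>[symmetric] by (simp add: L_def inner_simps inner_commute power2_eq_square algebra_simps)
  have Ls: "L v \<bullet> w = L w \<bullet> v" for v w by (simp add: L_def inner_simps inner_commute)
  define T where "T v = L (P (L v))" for v
  have PL: "P (L b) = P b - (\<kappa> * (d \<bullet> b)) *\<^sub>R P d" for b
    by (simp add: L_def P_diff P_scale)
  have "trace_op T = trace_op (\<lambda>v. K (P v))"
  proof -
    have Tb: "T b \<bullet> b = P b \<bullet> b - 2 * \<kappa> * ((P d \<bullet> b) * (d \<bullet> b))
       + \<kappa> * \<kappa> * (P d \<bullet> d) * ((d \<bullet> b) * (d \<bullet> b))" for b
    proof -
      have "T b \<bullet> b = P (L b) \<bullet> L b" unfolding T_def using Ls[of "P (L b)" b] by (simp add: inner_commute)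
      also have "\<dots> = P b \<bullet> b - 2 * \<kappa> * ((P d \<bullet> b) * (d \<bullet> b))
       + \<kappa> * \<kappa> * (P d \<bullet> d) * ((d \<bullet> b) * (d \<bullet> b))"
        unfolding PL using P_sym[of b d] by (simp add: L_def inner_simps inner_commute[of d "P _"] algebra_simps)
      finally show ?thesis .
    qed
    have "trace_op T = trace_op P - 2 * \<kappa> * (P d \<bullet> d) + \<kappa> * \<kappa> * (P d \<bullet> d) * (d \<bullet> d)"
      unfolding trace_op_def Tb
      by (simp only: sum.distrib sum_subtractf sum_distrib_left[symmetric] euclidean_inner[symmetric])
    also have "\<dots> = trace_op P - k * (P d \<bullet> d)" unfolding \<kappa>[symmetric] by (simp add: algebra_simps)
    finally show ?thesis by (simp add: trace_KP k_def)
  qed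
  moreover have "(\<Sum>b\<in>Basis. T b \<bullet> T b) = trace_op (\<lambda>v. K (P (K (P v))))"
  proof -
    have Tb: "T b \<bullet> T b = P b \<bullet> P b - 2 * \<kappa> * ((P (P d) \<bullet> b) * (d \<bullet> b))
       + \<kappa> * \<kappa> * (P d \<bullet> P d) * ((d \<bullet> b) * (d \<bullet> b))
       - k * ((L (P d) \<bullet> b) * (L (P d) \<bullet> b))" for b
    proof -
      have "T b \<bullet> T b = P (L b) \<bullet> P (L b) - k * (P d \<bullet> L b)\<^sup>2" by (simp add: T_def LL dP)
      also have "P d \<bullet> L b = L (P d) \<bullet> b" using Ls[of b "P d"] by (simp add: inner_commute)
      finally show ?thesis
        using P_sym[of "P d" b] by (simp add: PL inner_simps inner_commute power2_eq_square algebra_simps)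
    qed
    have "(\<Sum>b\<in>Basis. T b \<bullet> T b) = (\<Sum>b\<in>Basis. P b \<bullet> P b) - 2 * \<kappa> * (P (P d) \<bullet> d)
       + \<kappa> * \<kappa> * (P d \<bullet> P d) * (d \<bullet> d) - k * (L (P d) \<bullet> L (P d))"
      unfolding Tb
      by (simp only: sum.distrib sum_subtractf sum_distrib_left[symmetric] euclidean_inner[symmetric])
    also have "P (P d) \<bullet> d = P d \<bullet> P d" by (rule P_sym)
    also have "(\<Sum>b\<in>Basis. P b \<bullet> P b) - 2 * \<kappa> * (P d \<bullet> P d)
       + \<kappa> * \<kappa> * (P d \<bullet> P d) * (d \<bullet> d) = (\<Sum>b\<in>Basis. P b \<bullet> P b) - k * (P d \<bullet> P d)"
      unfolding \<kappa>[symmetric] by (simp add: algebra_simps)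
    finally show ?thesis unfolding trace_KPKP LL
      by (simp add: k_def inner_commute[of d] power2_eq_square algebra_simps)
  qed
  moreover have "(trace_op T)\<^sup>2 \<le> real DIM('a) * (\<Sum>b\<in>Basis. T b \<bullet> T b)"
  proof -
    have "(trace_op T)\<^sup>2 \<le> (\<Sum>b\<in>Basis. (T b \<bullet> b)\<^sup>2) * real DIM('a)"
      unfolding trace_op_def using sum_squared_le_sum_of_squares[of "\<lambda>b. T b \<bullet> b" Basis]
      by (simp add: mult.commute)
    also have "\<dots> \<le> (\<Sum>b\<in>Basis. T b \<bullet> T b) * real DIM('a)"
    proof (intro mult_right_mono sum_mono)
      fix b :: 'a assume "b \<in> Basis"
      then show "(T b \<bullet> b)\<^sup>2 \<le> T b \<bullet> T b" using Cauchy_Schwarz_ineq[of "T b" b] by simp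
    qed simp
    finally show ?thesis by (simp add: mult.commute)
  qed
  ultimately show ?thesis by simp
qed

end

section \<open>Trace bounds for positive semidefinite operators, to be applied to shifts P + c I and
  c I - P\<close>

locale positive_selfadjoint = selfadjoint_pair +
  assumes psd: "P v \<bullet> v \<ge> 0"
begin

text \<open>Compression to the orthogonal complement of \<open>d\<close> keeps \<open>P\<close>
  positive semidefinite, and the compressed operator has trace
  \<open>trace_op P - (P d \<bullet> d) / (d \<bullet> d)\<close>.\<close>

lemma inner_le_trace: "P d \<bullet> d \<le> (d \<bullet> d) * trace_op P"
proof (cases "d = 0")
  case True then show ?thesis by simp
next
  case False
  then have dd: "d \<bullet> d > 0" by simp
  define m where "m = 1 / (d \<bullet> d)"
  have "P (b - (m * (d \<bullet> b)) *\<^sub>R d) \<bullet> (b - (m * (d \<bullet> b)) *\<^sub>R d) =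
     P b \<bullet> b - 2 * m * ((P d \<bullet> b) * (d \<bullet> b)) + m * m * (P d \<bullet> d) * ((d \<bullet> b) * (d \<bullet> b))" for b
    using P_sym[of b d] by (simp add: P_diff P_scale inner_simps algebra_simps)
  then have "0 \<le> P b \<bullet> b - 2 * m * ((P d \<bullet> b) * (d \<bullet> b)) + m * m * (P d \<bullet> d) * ((d \<bullet> b) * (d \<bullet> b))" for b
    using psd[of "b - (m * (d \<bullet> b)) *\<^sub>R d"] by simp
  then have "0 \<le> (\<Sum>b\<in>Basis. P b \<bullet> b - 2 * m * ((P d \<bullet> b) * (d \<bullet> b)) + m * m * (P d \<bullet> d) * ((d \<bullet> b) * (d \<bullet> b)))"
    by (rule sum_nonneg)
  also have "\<dots> = trace_op P - 2 * m * (P d \<bullet> d) + m * m * (P d \<bullet> d) * (d \<bullet> d)"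
    by (simp only: sum.distrib sum_subtractf sum_distrib_left[symmetric] euclidean_inner[symmetric] trace_op_def)
  also have "\<dots> = trace_op P - (P d \<bullet> d) / (d \<bullet> d)" using dd by (simp add: m_def)
  finally show ?thesis using dd by (simp add: field_simps)
qed

lemma trace_nonneg: "trace_op P \<ge> 0" by (simp add: trace_op_def psd sum_nonneg)

lemma inner_Basis_le_trace: "b \<in> Basis \<Longrightarrow> P b \<bullet> b \<le> trace_op P"
  unfolding trace_op_def by (rule member_le_sum) (auto simp: psd)

text \<open>Positivity on \<open>b + c\<close> and \<open>b - c\<close> bounds each entry
  \<open>P b \<bullet> c\<close> of the column \<open>P b\<close> by the trace.\<close>

lemma norm_Basis_le_trace:
  assumes b: "b \<in> Basis" shows "P b \<bullet> P b \<le> real DIM('a) * (trace_op P)\<^sup>2"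
proof -
  have "(P b \<bullet> c)\<^sup>2 \<le> (trace_op P)\<^sup>2" if c: "c \<in> Basis" for c
  proof -
    have "P (b + c) \<bullet> (b + c) = P b \<bullet> b + P c \<bullet> c + 2 * (P b \<bullet> c)"
      "P (b - c) \<bullet> (b - c) = P b \<bullet> b + P c \<bullet> c - 2 * (P b \<bullet> c)"
      using P_sym[of b c] by (simp_all add: P_diff P_add inner_simps)
    then have "\<bar>P b \<bullet> c\<bar> \<le> trace_op P"
      using psd[of "b + c"] psd[of "b - c"] inner_Basis_le_trace[OF b] inner_Basis_le_trace[OF c]
      by linarith
    then show ?thesis using trace_nonneg by (simp flip: abs_le_square_iff)
  qed
  then have "(\<Sum>c\<in>Basis. (P b \<bullet> c)\<^sup>2) \<le> (\<Sum>c\<in>(Basis::'a set). (trace_op P)\<^sup>2)" by (rule sum_mono)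
  then show ?thesis using euclidean_inner[of "P b" "P b"] by (simp add: power2_eq_square)
qed

end

section \<open>Almost minimal points\<close>

text \<open>On the line through \<open>p\<close> in direction \<open>v\<close>, a negative second
  derivative would make the first derivative, which vanishes at \<open>p\<close>, negative just
  beyond it, and \<open>\<phi>\<close> would fall below its minimum.\<close>

lemma minimum_first_second_derivative:
  fixes \<phi> :: "'a::euclidean_space \<Rightarrow> real"
  assumes d1: "\<And>x. (\<phi> has_derivative (\<lambda>v. g x \<bullet> v)) (at x)"
    and d2: "\<And>x. (g has_derivative h x) (at x)"
    and min: "\<And>x. \<phi> p \<le> \<phi> x"
  shows "g p = 0" "h p v \<bullet> v \<ge> 0"
proof -
  have "(\<lambda>v. g p \<bullet> v) = (\<lambda>v. 0)"
    by (rule differential_zero_maxmin[of p UNIV \<phi>]) (use min d1 in auto)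
  then show g: "g p = 0" by (metis inner_eq_zero_iff)
  let ?r = "\<lambda>t. \<phi> (p + t *\<^sub>R v)" and ?r' = "\<lambda>t. g (p + t *\<^sub>R v) \<bullet> v"
  have lin: "linear (h p)" using d2 has_derivative_linear by blast
  have r: "(?r has_real_derivative ?r' t) (at t)" for t
    by (rule has_derivative_along_line[OF d1])
  have r': "(?r' has_real_derivative (h p v \<bullet> v)) (at 0)"
  proof -
    have "((\<lambda>t. p + t *\<^sub>R v) has_derivative (\<lambda>t. t *\<^sub>R v)) (at 0)"
      by (auto intro!: derivative_eq_intros)
    moreover have "(g has_derivative h p) (at (p + 0 *\<^sub>R v))" using d2 by simp
    ultimately have "((\<lambda>t. g (p + t *\<^sub>R v)) has_derivative (\<lambda>t. h p (t *\<^sub>R v))) (at 0)"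
      by (rule has_derivative_compose)
    from has_derivative_inner_left[OF this, of v] show ?thesis
      unfolding has_field_derivative_def using lin
      by (simp add: linear_scale mult.commute[of _ "h p v \<bullet> v"])
  qed
  show "h p v \<bullet> v \<ge> 0"
  proof (rule ccontr)
    assume "\<not> h p v \<bullet> v \<ge> 0"
    then obtain e where e: "e > 0" "\<And>t. 0 < t \<Longrightarrow> t < e \<Longrightarrow> ?r' t < ?r' 0"
      using DERIV_neg_dec_right[OF r'] by auto
    from MVT2[of 0 "e/2" ?r ?r', OF _ r] obtain z where z: "0 < z" "z < e / 2"
      and "?r (e / 2) - ?r 0 = e / 2 * ?r' z" using e(1) by auto
    moreover have "?r' z < 0" using e(2)[of z] z g by simp
    then have "e / 2 * ?r' z < 0" using e(1) by (simp add: mult_pos_neg)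
    ultimately show False using min[of "p + (e / 2) *\<^sub>R v"] by simp
  qed
qed

text \<open>The quadratic penalty makes the infimum attained. At the minimiser the gradient of
  \<open>\<phi>\<close> is \<open>- (2 * \<epsilon>) *\<^sub>R p\<close>, and comparison with the
  origin bounds \<open>\<epsilon> * (p \<bullet> p)\<close> by \<open>\<phi> 0\<close>.\<close>

lemma approximate_minimum:
  fixes \<phi> :: "'a::euclidean_space \<Rightarrow> real"
  assumes d1: "\<And>x. (\<phi> has_derivative (\<lambda>v. g x \<bullet> v)) (at x)"
    and d2: "\<And>x. (g has_derivative h x) (at x)"
    and nonneg: "\<And>x. \<phi> x \<ge> 0" and "\<epsilon> > 0"
  obtains p where "\<phi> p \<le> \<phi> 0" "g p \<bullet> g p \<le> 4 * \<epsilon> * \<phi> 0"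
    "\<And>v. - 2 * \<epsilon> * (v \<bullet> v) \<le> h p v \<bullet> v"
proof -
  let ?\<phi> = "\<lambda>x. \<phi> x + \<epsilon> * (x \<bullet> x)"
  \<comment> \<open>Outside this ball the penalty alone exceeds \<open>\<phi> 0\<close>, because
    there \<open>x \<bullet> x \<ge> r * r \<ge> r\<close> and
    \<open>\<epsilon> * r = \<phi> 0 + \<epsilon>\<close>. The summand 1 secures
    \<open>r \<ge> 1\<close>.\<close>
  define r where "r = \<phi> 0 / \<epsilon> + 1"
  have r: "r \<ge> 1" using nonneg[of 0] \<open>\<epsilon> > 0\<close> by (simp add: r_def)
  have D1: "(?\<phi> has_derivative (\<lambda>v. (g x + (2 * \<epsilon>) *\<^sub>R x) \<bullet> v)) (at x)" for x
    by (auto intro!: derivative_eq_intros d1 simp: algebra_simps inner_commute)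
  have D2: "((\<lambda>x. g x + (2 * \<epsilon>) *\<^sub>R x) has_derivative (\<lambda>v. h x v + (2 * \<epsilon>) *\<^sub>R v)) (at x)" for x
    by (auto intro!: derivative_eq_intros d2)
  have "continuous_on (cball 0 r) ?\<phi>"
    by (rule has_derivative_continuous_on[OF has_derivative_at_withinI[OF D1]])
  then have "\<exists>p\<in>cball 0 r. \<forall>x\<in>cball 0 r. ?\<phi> p \<le> ?\<phi> x"
    using r by (intro continuous_attains_inf) auto
  then obtain p where p: "\<And>x. x \<in> cball 0 r \<Longrightarrow> ?\<phi> p \<le> ?\<phi> x"
    by blast
  have min: "?\<phi> p \<le> ?\<phi> x" for x
  proof (cases "x \<in> cball 0 r")
    case False
    then have "norm x \<ge> r" by simp
    then have "x \<bullet> x \<ge> r * r" using r by (simp add: dot_square_norm power2_eq_square mult_mono)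
    moreover have "r * r \<ge> r" using r by simp
    ultimately have "\<epsilon> * (x \<bullet> x) \<ge> \<epsilon> * r" using \<open>\<epsilon> > 0\<close> by (intro mult_left_mono) auto
    also have "\<epsilon> * r = \<phi> 0 + \<epsilon>" using \<open>\<epsilon> > 0\<close> by (simp add: r_def field_simps)
    finally show ?thesis using p[of 0] r nonneg[of x] \<open>\<epsilon> > 0\<close> by simp
  qed (rule p)
  have gp: "g p = - (2 * \<epsilon>) *\<^sub>R p"
    using minimum_first_second_derivative(1)[OF D1 D2 min] by (simp add: eq_neg_iff_add_eq_0)
  have m0: "\<phi> p + \<epsilon> * (p \<bullet> p) \<le> \<phi> 0" using min[of 0] by simp
  show ?thesis
  proof (rule that)
    show "\<phi> p \<le> \<phi> 0"
      using m0 \<open>\<epsilon> > 0\<close> by (smt (verit) inner_ge_zero mult_nonneg_nonneg)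
    have "\<epsilon> * (p \<bullet> p) \<le> \<phi> 0" using m0 nonneg[of p] by simp
    then have "4 * \<epsilon> * (\<epsilon> * (p \<bullet> p)) \<le> 4 * \<epsilon> * \<phi> 0" using \<open>\<epsilon> > 0\<close> by simp
    then show "g p \<bullet> g p \<le> 4 * \<epsilon> * \<phi> 0" by (simp add: gp mult_ac)
    show "- 2 * \<epsilon> * (v \<bullet> v) \<le> h p v \<bullet> v" for v
      using minimum_first_second_derivative(2)[OF D1 D2 min, of v] by (simp add: inner_simps)
  qed
qed

section \<open>Mean and scalar curvature\<close>

context three_jet
begin

text \<open>In the upper half-space model the graph is the Euclidean graph of \<open>f\<close>, which has gradient \<open>d\<close>.\<close>

definition "f p = exp (- u p)"
definition "d p = - f p *\<^sub>R G p"
definition "hess p v = f p *\<^sub>R ((G p \<bullet> v) *\<^sub>R G p - S p v)"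
definition "P p v = f p *\<^sub>R hess p v"

lemma f_pos: "f p > 0" by (simp add: f_def)

lemma E_f: "E p * (f p * f p) = 1"
  by (simp add: E_def f_def power2_eq_square flip: exp_add)

lemma has_derivative_f: "(f has_derivative (\<lambda>v. d p \<bullet> v)) (at p)"
  unfolding f_def[abs_def] d_def by (auto intro!: derivative_eq_intros du)

lemma has_derivative_d: "(d has_derivative hess p) (at p)"
proof -
  have "(d has_derivative (\<lambda>v. - f p *\<^sub>R S p v + - (d p \<bullet> v) *\<^sub>R G p)) (at p)"
    unfolding d_def[abs_def]
    by (intro has_derivative_scaleR has_derivative_minus has_derivative_f[unfolded d_def] dG)
  then show ?thesis
    by (rule has_derivative_eq_rhs) (simp add: fun_eq_iff hess_def d_def algebra_simps)
qed

sublocale pair: selfadjoint_pair "P p" "d p" for p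
proof (rule selfadjoint_pair.intro)
  show "linear (P p)"
    by (rule linearI) (simp_all add: P_def hess_def S_add S_scale inner_simps algebra_simps)
  show "P p v \<bullet> w = P p w \<bullet> v" for v w
    using S_sym[of p v w] by (simp add: P_def hess_def inner_simps mult.commute)
qed

lemma d_d: "E p * (d p \<bullet> d p) = G p \<bullet> G p"
  using E_f[of p] by (simp add: d_def)

lemma W_s: "(pair.W p)\<^sup>2 * (E p * s p) = 1"
proof -
  have "(pair.W p)\<^sup>2 * (E p * s p) = s p * (E p + E p * (d p \<bullet> d p))"
    by (simp add: pair.W_square algebra_simps)
  then show ?thesis by (simp add: d_d s_eq)
qed

text \<open>As \<open>d p = - f p *\<^sub>R G p\<close> and \<open>E p * (f p * f p) = 1\<close>,
  the metric \<open>met p\<close> is \<open>E p\<close> times the Euclidean first fundamental form I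
  + d d^T of the graph of \<open>f\<close>; hence both inverses carry the same rank-one
  correction.\<close>

lemma K_eq: "pair.K p v = v - (s p * (G p \<bullet> v)) *\<^sub>R G p"
proof -
  have "(pair.W p)\<^sup>2 \<noteq> 0" using pair.W_ge_1[of p] by simp
  then have "1 / (pair.W p)\<^sup>2 = E p * s p" using W_s[of p] by (simp add: field_simps)
  then have "pair.K p v = v - (E p * s p * (d p \<bullet> v)) *\<^sub>R d p"
    by (simp add: pair.K_def divide_inverse mult.commute)
  also have "(E p * s p * (d p \<bullet> v)) *\<^sub>R d p = ((E p * (f p * f p)) * s p * (G p \<bullet> v)) *\<^sub>R G p"
    by (simp add: d_def mult_ac)
  finally show ?thesis by (simp add: E_f)
qed

lemma E_P: "E p *\<^sub>R P p v = (G p \<bullet> v) *\<^sub>R G p - S p v"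
proof -
  have "E p *\<^sub>R P p v = (E p * (f p * f p)) *\<^sub>R ((G p \<bullet> v) *\<^sub>R G p - S p v)"
    by (simp add: P_def hess_def)
  then show ?thesis by (simp add: E_f)
qed

text \<open>Combined with \<open>\<theta> p = - 1 / pair.W p\<close> below, this turns the shape
  operator \<open>(\<theta> p / E p) *\<^sub>R C p v\<close> into (I + K P) / W.\<close>

lemma C_K: "C p v = - E p *\<^sub>R (v + pair.K p (P p v))"
proof -
  have "E p *\<^sub>R pair.K p (P p v) = E p *\<^sub>R P p v - (s p * (G p \<bullet> (E p *\<^sub>R P p v))) *\<^sub>R G p"
    by (simp add: K_eq algebra_simps)
  also have "\<dots> = ((G p \<bullet> v) - s p * ((G p \<bullet> v) * (G p \<bullet> G p) - G p \<bullet> S p v)) *\<^sub>R G p - S p v"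
    unfolding E_P by (simp add: inner_simps algebra_simps)
  also have "(G p \<bullet> v) - s p * ((G p \<bullet> v) * (G p \<bullet> G p) - G p \<bullet> S p v)
      = s p * (E p * (G p \<bullet> v) + S p v \<bullet> G p)"
    using s_eq[of p] by (simp add: inner_commute[of _ "S p v"]) algebra
  finally show ?thesis by (simp add: C_eq scaleR_add_right)
qed

definition "tr1 p = trace_op (\<lambda>v. pair.K p (P p v))"
definition "tr2 p = trace_op (\<lambda>v. pair.K p (P p (pair.K p (P p v))))"

lemma trace_C: "trace_op (C p) = - E p * (real DIM('a) + tr1 p)"
proof -
  have "trace_op (C p) = (\<Sum>b\<in>Basis. - E p * (1 + pair.K p (P p b) \<bullet> b))"
    unfolding trace_op_def C_K by (intro sum.cong) (auto simp: inner_simps)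
  then show ?thesis by (simp only: sum_distrib_left[symmetric]) (simp add: sum.distrib tr1_def trace_op_def)
qed

lemma trace_CC: "trace_op (\<lambda>v. C p (C p v)) = (E p)\<^sup>2 * (real DIM('a) + 2 * tr1 p + tr2 p)"
proof -
  have K: "pair.K p (v + w) = pair.K p v + pair.K p w" "pair.K p (c *\<^sub>R v) = c *\<^sub>R pair.K p v" for v w c
    by (simp_all add: K_eq inner_simps algebra_simps)
  have "C p (C p v) = (E p)\<^sup>2 *\<^sub>R (v + 2 *\<^sub>R pair.K p (P p v) + pair.K p (P p (pair.K p (P p v))))" for v
    unfolding C_K pair.P_scale pair.P_add K
    by (simp add: power2_eq_square scaleR_2 algebra_simps)
  then have "trace_op (\<lambda>v. C p (C p v)) = (\<Sum>b\<in>Basis. (E p)\<^sup>2 * (1 + 2 * (pair.K p (P p b) \<bullet> b)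
      + pair.K p (P p (pair.K p (P p b))) \<bullet> b))"
    by (simp add: trace_op_def inner_simps)
  also have "\<dots> = (E p)\<^sup>2 * (real DIM('a) + 2 * tr1 p + tr2 p)"
    by (simp add: sum_distrib_left[symmetric] sum.distrib tr1_def tr2_def trace_op_def)
  finally show ?thesis .
qed

text \<open>This is R = - n (n - 1) + (tr A)^2 - tr A^2 for A = (I + K P) / W: the factor
  \<open>s p / E p\<close> meets the \<open>(E p)\<^sup>2\<close> of both traces and leaves
  \<open>E p * s p\<close>, the inverse square of W.\<close>

lemma scalar_curvature_eq:
  "scalar_curvature met p = - real DIM('a) * (real DIM('a) - 1)
    + ((real DIM('a) + tr1 p)\<^sup>2 - (real DIM('a) + 2 * tr1 p + tr2 p)) / (pair.W p)\<^sup>2"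
proof -
  have E: "E p \<noteq> 0" using E_pos[of p] by simp
  have "(pair.W p)\<^sup>2 \<noteq> 0" using pair.W_ge_1[of p] by simp
  then have W: "1 / (pair.W p)\<^sup>2 = E p * s p" using W_s[of p] by (simp add: field_simps)
  have "s p / E p * ((trace_op (C p))\<^sup>2 - trace_op (\<lambda>v. C p (C p v)))
     = s p / E p * ((E p)\<^sup>2 * ((real DIM('a) + tr1 p)\<^sup>2 - (real DIM('a) + 2 * tr1 p + tr2 p)))"
    by (simp add: trace_C trace_CC power_mult_distrib right_diff_distrib)
  also have "\<dots> = E p * s p * ((real DIM('a) + tr1 p)\<^sup>2 - (real DIM('a) + 2 * tr1 p + tr2 p))"
    using E by (simp add: power2_eq_square)
  finally show ?thesis unfolding scalar_curvature_met W[symmetric] by simp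
qed

end

section \<open>Lower bound for a constant mean curvature, from almost minimal points of
  \<open>f\<close>\<close>

context normal_graph
begin

lemma \<theta>_eq: "\<theta> p = - 1 / pair.W p"
proof -
  have W: "pair.W p > 0" using pair.W_ge_1[of p] by simp
  have "(- \<theta> p * pair.W p)\<^sup>2 = 1"
    using W_s[of p] by (simp add: power_mult_distrib \<theta>_square mult.commute)
  moreover have "- \<theta> p * pair.W p > 0" using W downward[of p] by (simp add: mult_neg_pos)
  ultimately have "- \<theta> p * pair.W p = 1" by (simp add: power2_eq_1_iff)
  then show ?thesis using W by (simp add: field_simps)
qed

lemma mean_curvature_W:
  "real DIM('a) * mean_curvature warped_metric (vertical_graph u) N p * pair.W p = real DIM('a) + tr1 p"
  using pair.W_ge_1[of p] E_pos[of p] by (simp add: mean_curvature_eq trace_C \<theta>_eq)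

lemma constant_mean_curvature_ge_1:
  assumes H: "\<And>p. mean_curvature warped_metric (vertical_graph u) N p = H" and "H \<ge> 0"
  shows "H \<ge> 1"
proof (rule ccontr)
  let ?n = "real DIM('a)"
  assume "\<not> H \<ge> 1"
  then have H1: "H < 1" by simp
  \<comment> \<open>Here \<open>c\<close> is arbitrary; the final choice \<open>(1 - H) / 4\<close>
    yields \<open>1 - H \<le> (1 - H) / 2\<close>.\<close>
  have key: "1 - H \<le> 2 * c" if c: "c > 0" for c
  proof -
    \<comment> \<open>With this value and \<open>f p \<le> f 0\<close>, the Hessian bound becomes P
      \<ge> - c I, and the gradient bound becomes
      \<open>d p \<bullet> d p \<le> 2 * c\<close>.\<close>
    define \<epsilon> where "\<epsilon> = c / (2 * f 0)"
    have \<epsilon>: "\<epsilon> > 0" using c f_pos[of 0] by (simp add: \<epsilon>_def)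
    have \<epsilon>c: "2 * \<epsilon> * f 0 = c" using f_pos[of 0] by (simp add: \<epsilon>_def)
    obtain p where p: "f p \<le> f 0" "d p \<bullet> d p \<le> 4 * \<epsilon> * f 0"
      "\<And>v. - 2 * \<epsilon> * (v \<bullet> v) \<le> hess p v \<bullet> v"
      by (rule approximate_minimum[OF has_derivative_f has_derivative_d less_imp_le[OF f_pos] \<epsilon>]) (rule that)
    interpret Q: positive_selfadjoint "\<lambda>v. P p v + c *\<^sub>R v" "d p"
    proof (intro positive_selfadjoint.intro selfadjoint_pair.intro positive_selfadjoint_axioms.intro)
      show "linear (\<lambda>v. P p v + c *\<^sub>R v)"
        by (rule linearI) (simp_all add: pair.P_add pair.P_scale algebra_simps)
      show "(P p v + c *\<^sub>R v) \<bullet> w = (P p w + c *\<^sub>R w) \<bullet> v" for v w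
        by (simp add: inner_simps pair.P_sym[of p v w] inner_commute[of v w])
      fix v :: 'a
      have "f p * (- 2 * \<epsilon> * (v \<bullet> v)) \<le> f p * (hess p v \<bullet> v)"
        using p(3) f_pos[of p] by (intro mult_left_mono) auto
      moreover have "f p * (2 * \<epsilon> * (v \<bullet> v)) \<le> f 0 * (2 * \<epsilon> * (v \<bullet> v))"
        using p(1) \<epsilon> by (intro mult_right_mono) auto
      moreover have "f 0 * (2 * \<epsilon> * (v \<bullet> v)) = c * (v \<bullet> v)" unfolding \<epsilon>c[symmetric] by simp
      ultimately show "0 \<le> (P p v + c *\<^sub>R v) \<bullet> v" by (simp add: P_def inner_simps)
    qed
    let ?Q = "\<lambda>v. P p v + c *\<^sub>R v" and ?W = "pair.W p"
    have W: "?W \<ge> 1" "?W\<^sup>2 = 1 + d p \<bullet> d p" by (rule pair.W_ge_1, rule pair.W_square)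
    \<comment> \<open>Equivalent to tr (K Q) \<ge> 0 for the positive operator \<open>?Q\<close>;
      removing the shift by \<open>c\<close> costs at most n c, so tr (K P) \<ge> - n c.\<close>
    have "?Q (d p) \<bullet> d p \<le> ?W\<^sup>2 * trace_op ?Q"
      using Q.inner_le_trace Q.trace_nonneg W(2) by (simp add: distrib_right add_increasing)
    then have 1: "?Q (d p) \<bullet> d p / ?W\<^sup>2 \<le> trace_op ?Q"
      using W(1) by (simp add: divide_le_eq mult.commute)
    have "trace_op ?Q = trace_op (P p) + ?n * c"
      by (simp add: trace_op_def inner_simps sum.distrib)
    moreover have "?Q (d p) \<bullet> d p / ?W\<^sup>2 \<ge> (P p (d p) \<bullet> d p) / ?W\<^sup>2"
      using c by (simp add: inner_simps divide_right_mono)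
    ultimately have "tr1 p \<ge> - ?n * c"
      using 1 by (simp add: tr1_def pair.trace_KP)
    then have "?n * (H * ?W) \<ge> ?n * (1 - c)"
      using mean_curvature_W[of p] by (simp add: H algebra_simps)
    then have HW: "H * ?W \<ge> 1 - c" by simp
    \<comment> \<open>The small gradient keeps W near 1, so that 1 - c \<le> H W \<le> H (1 + c)
      \<le> H + c.\<close>
    have "?W\<^sup>2 \<le> 1 + 2 * c" using p(2) \<epsilon>c unfolding W(2) by linarith
    also have "\<dots> \<le> (1 + c)\<^sup>2" by (simp add: power2_eq_square algebra_simps)
    finally have "?W \<le> 1 + c" using c by (simp add: power2_le_iff_abs_le)
    then have "H * ?W \<le> H * (1 + c)" using \<open>H \<ge> 0\<close> by (rule mult_left_mono)
    moreover have "H * c \<le> 1 * c" using H1 c by (intro mult_right_mono) auto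
    ultimately show ?thesis using HW by (simp add: algebra_simps)
  qed
  from key[of "(1 - H) / 4"] H1 show False by simp
qed

section \<open>Scalar curvature when H = 1\<close>

context
  assumes H1: "\<And>p. mean_curvature warped_metric (vertical_graph u) N p = 1"
begin

lemma tr1_eq: "tr1 p = real DIM('a) * (pair.W p - 1)"
  using mean_curvature_W[of p] by (simp add: H1 algebra_simps)

text \<open>Now tr A = n, so this is R = n - tr A^2, expressed through \<open>tr2\<close> after
  replacing n + \<open>tr1 p\<close> by n W.\<close>

lemma scalar_curvature_tr2:
  "scalar_curvature met p = (real DIM('a) * (pair.W p - 1)\<^sup>2 - tr2 p) / (pair.W p)\<^sup>2"
proof -
  let ?n = "real DIM('a)"
  have W: "(pair.W p)\<^sup>2 \<noteq> 0" using pair.W_ge_1[of p] by simp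
  have "scalar_curvature met p = (- ?n * (?n - 1) * (pair.W p)\<^sup>2
      + ((?n + tr1 p)\<^sup>2 - (?n + 2 * tr1 p + tr2 p))) / (pair.W p)\<^sup>2"
    unfolding scalar_curvature_eq add_divide_distrib using W by simp
  also have "- ?n * (?n - 1) * (pair.W p)\<^sup>2 + ((?n + tr1 p)\<^sup>2 - (?n + 2 * tr1 p + tr2 p))
    = ?n * (pair.W p - 1)\<^sup>2 - tr2 p"
    unfolding tr1_eq by (simp add: power2_eq_square algebra_simps)
  finally show ?thesis .
qed

text \<open>Since \<open>tr1 p\<close> is n (W - 1), the trace inequality
  \<open>trace_KP_square_le\<close> bounds \<open>tr2 p\<close> below by exactly the positive term
  of \<open>scalar_curvature_tr2\<close>.\<close>

lemma scalar_curvature_nonpos: "scalar_curvature met p \<le> 0"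
proof -
  let ?n = "real DIM('a)"
  have "?n * (?n * (pair.W p - 1)\<^sup>2) \<le> ?n * tr2 p"
    using pair.trace_KP_square_le[of p]
    by (simp add: tr1_def[symmetric] tr2_def[symmetric] tr1_eq power2_eq_square algebra_simps)
  then have "?n * (pair.W p - 1)\<^sup>2 \<le> tr2 p" by simp
  then show ?thesis unfolding scalar_curvature_tr2 by (simp add: divide_le_0_iff)
qed

lemma scalar_curvature_close_to_0:
  assumes u: "\<And>x. u x \<ge> 0" and \<alpha>: "\<alpha> > 0"
  shows "\<exists>p. scalar_curvature met p > - \<alpha>"
proof -
  let ?n = "real DIM('a)"
  \<comment> \<open>M c^2 will bound the sum of \<open>P p b \<bullet> P p b\<close> over the basis:
    each summand is at most 2 c^2 plus twice n (3 n c)^2, which explains 18, and the outer factor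
    counts the basis vectors. With \<open>c \<le> 1\<close> and
    \<open>c * M \<le> \<alpha> / 2\<close> the sum is below \<open>\<alpha>\<close>.\<close>
  define M where "M = ?n * (2 + 18 * ?n ^ 3)"
  have M: "M > 0" by (simp add: M_def add_pos_pos)
  define c where "c = min 1 (\<alpha> / (2 * M))"
  have c: "c > 0" "c \<le> 1" "c * M \<le> \<alpha> / 2"
    using M \<alpha> by (auto simp: c_def min_def field_simps)
  \<comment> \<open>Nonnegative height makes \<open>1 - f\<close> nonnegative; its almost minimal
    points are the almost maximal points of \<open>f\<close>.\<close>
  have f1: "f x \<le> 1" for x using u[of x] by (simp add: f_def)
  have n1: "((\<lambda>x. 1 - f x) has_derivative (\<lambda>v. (- d x) \<bullet> v)) (at x)" for x
    by (auto intro!: derivative_eq_intros has_derivative_f)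
  have n2: "((\<lambda>x. - d x) has_derivative (\<lambda>v. - hess x v)) (at x)" for x
    by (intro has_derivative_minus has_derivative_d)
  have "1 - f x \<ge> 0" for x using f1[of x] by simp
  then obtain p where p: "(- d p) \<bullet> (- d p) \<le> 4 * (c / 2) * (1 - f 0)"
      "\<And>v. - 2 * (c / 2) * (v \<bullet> v) \<le> (- hess p v) \<bullet> v"
    by (rule approximate_minimum[OF n1 n2 _ half_gt_zero[OF c(1)]]) (rule that)
  interpret Q: positive_selfadjoint "\<lambda>v. c *\<^sub>R v - P p v" "d p"
  proof (intro positive_selfadjoint.intro selfadjoint_pair.intro positive_selfadjoint_axioms.intro)
    show "linear (\<lambda>v. c *\<^sub>R v - P p v)"
      by (rule linearI) (simp_all add: pair.P_add pair.P_scale algebra_simps)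
    show "(c *\<^sub>R v - P p v) \<bullet> w = (c *\<^sub>R w - P p w) \<bullet> v" for v w
      by (simp add: inner_simps pair.P_sym[of p v w] inner_commute[of v w])
    fix v :: 'a
    have "f p * (hess p v \<bullet> v) \<le> f p * (c * (v \<bullet> v))"
      using p(2)[of v] f_pos[of p] by (intro mult_left_mono) auto
    also have "\<dots> \<le> 1 * (c * (v \<bullet> v))" using f1 c by (intro mult_right_mono) auto
    finally show "0 \<le> (c *\<^sub>R v - P p v) \<bullet> v" by (simp add: P_def inner_simps)
  qed
  let ?Q = "\<lambda>v. c *\<^sub>R v - P p v" and ?W = "pair.W p"
  have W: "?W \<ge> 1" "?W\<^sup>2 = 1 + d p \<bullet> d p" by (rule pair.W_ge_1, rule pair.W_square)
  have W0: "?W\<^sup>2 > 0" using W(1) by simp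
  \<comment> \<open>The squared gradient is at most \<open>2 * c\<close>, hence at most 2.\<close>
  have "c * (1 - f 0) \<le> c * 1" using f_pos[of 0] c by (intro mult_left_mono) auto
  moreover have "d p \<bullet> d p \<le> 2 * (c * (1 - f 0))" using p(1) by simp
  ultimately have W3: "?W\<^sup>2 \<le> 3" using c unfolding W(2) by linarith
  have trQ: "trace_op ?Q = ?n * c - trace_op (P p)"
    by (simp add: trace_op_def inner_simps sum_subtractf)
  \<comment> \<open>As tr (K P) = n (W - 1) is nonnegative, tr (K Q) \<le> c tr K \<le> n c; and K
    \<ge> I / W^2 gives tr Q \<le> W^2 tr (K Q). A positive operator with small trace is small, so
    this controls P from both sides.\<close>
  have "trace_op ?Q \<le> ?W\<^sup>2 * (?n * c)"
  proof -
    have "0 \<le> tr1 p" using tr1_eq[of p] W(1) by simp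
    then have "P p (d p) \<bullet> d p \<le> ?W\<^sup>2 * trace_op (P p)"
      using W0 by (simp add: tr1_def pair.trace_KP divide_le_eq mult.commute)
    moreover have "c * (d p \<bullet> d p) - P p (d p) \<bullet> d p \<le> (?W\<^sup>2 - 1) * trace_op ?Q"
      using Q.inner_le_trace unfolding W(2) by (simp add: inner_simps)
    moreover have "c * (d p \<bullet> d p) \<ge> 0" using c by simp
    moreover have "?W\<^sup>2 * trace_op (P p) = ?W\<^sup>2 * (?n * c) - ?W\<^sup>2 * trace_op ?Q"
      unfolding trQ by (simp add: algebra_simps)
    moreover have "(?W\<^sup>2 - 1) * trace_op ?Q = ?W\<^sup>2 * trace_op ?Q - trace_op ?Q"
      by (simp add: algebra_simps)
    ultimately show ?thesis by linarith
  qed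
  also have "\<dots> \<le> 3 * (?n * c)" using W3 c by (intro mult_right_mono) auto
  finally have "trace_op ?Q \<le> 3 * ?n * c" by simp
  then have trQ2: "(trace_op ?Q)\<^sup>2 \<le> (3 * ?n * c)\<^sup>2"
    using Q.trace_nonneg by (rule power_mono)
  have "P p b \<bullet> P p b \<le> (2 + 18 * ?n ^ 3) * c\<^sup>2" if b: "b \<in> Basis" for b
  proof -
    have eq: "P p b = c *\<^sub>R b - ?Q b" by simp
    \<comment> \<open>The parallelogram inequality for the difference of
      \<open>c *\<^sub>R b\<close> and \<open>?Q b\<close>.\<close>
    have "P p b \<bullet> P p b \<le> 2 * (c\<^sup>2 * (b \<bullet> b)) + 2 * (?Q b \<bullet> ?Q b)"
    proof -
      have "0 \<le> (c *\<^sub>R b + ?Q b) \<bullet> (c *\<^sub>R b + ?Q b)" by (rule inner_ge_zero)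
      then show ?thesis
        by (simp add: inner_simps inner_commute[of "P p b" b] power2_eq_square algebra_simps)
    qed
    also have "?Q b \<bullet> ?Q b \<le> ?n * (3 * ?n * c)\<^sup>2"
      using Q.norm_Basis_le_trace[OF b] mult_left_mono[OF trQ2, of ?n] by linarith
    finally show ?thesis using b by (simp add: power2_eq_square power3_eq_cube algebra_simps)
  qed
  then have "(\<Sum>b\<in>Basis. P p b \<bullet> P p b) \<le> (\<Sum>b\<in>(Basis::'a set). (2 + 18 * ?n ^ 3) * c\<^sup>2)"
    by (rule sum_mono)
  also have "\<dots> = M * c * c" by (simp add: M_def power2_eq_square)
  also have "\<dots> \<le> M * c * 1" using c M by (intro mult_left_mono) auto
  also have "\<dots> < \<alpha>" using c \<alpha> by (simp add: mult.commute)
  finally have tr2: "tr2 p < \<alpha>" using pair.trace_KPKP_le[of p] by (simp add: tr2_def)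
  have "- \<alpha> * ?W\<^sup>2 \<le> - \<alpha> * 1" using W(2) \<alpha> by (intro mult_left_mono_neg) auto
  also have "\<dots> < ?n * (?W - 1)\<^sup>2 - tr2 p"
    using tr2 by (smt (verit) mult_nonneg_nonneg of_nat_0_le_iff zero_le_power2)
  finally have "- \<alpha> < scalar_curvature met p"
    unfolding scalar_curvature_tr2 using W0 by (simp add: pos_less_divide_eq)
  then show ?thesis ..
qed

end
end

section \<open>Both conclusions, from the pointwise formulas for the given graph\<close>

theorem theorem5p1:
  fixes u :: "real ^ 'n \<Rightarrow> real"
    and \<psi> N :: "real ^ 'n \<Rightarrow> real \<times> (real ^ 'n)"
    and g :: "(real ^ 'n) riem_metric"
    and H :: real
  assumes "CARD('n) \<ge> 2"
    and "smooth_map u" and "\<And>x. u x \<ge> 0"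
    and \<psi>: "\<psi> = vertical_graph u"
    and g: "g = induced_metric warped_metric \<psi>"
    and "riem_complete g"
    and "ricci_bounded_below g"
    and "unit_normal_field warped_metric \<psi> N"
    and "\<And>x. warped_metric (\<psi> x) (N x) d_t < 0"
    and "\<And>x. mean_curvature warped_metric \<psi> N x = H" and "0 \<le> H" and "H \<le> 1"
    and "\<And>x. warped_metric (\<psi> x) (N x) d_t \<noteq> -1 \<Longrightarrow>
           height \<psi> x \<le> - ln (1 + warped_metric (\<psi> x) (N x) d_t)"
  shows "(\<forall>x. mean_curvature warped_metric \<psi> N x = 1) \<and>
    (\<forall>a \<Phi>. admissible_null_vector a \<longrightarrow> model_isometry a \<Phi> \<longrightarrow>
       top_of_set de_sitter closure_of (range (lorentz_gauss_map \<Phi> \<psi> N)) \<subseteq> steady_state a \<longrightarrow>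
       (\<forall>x. scalar_curvature g x \<le> 0) \<and>
       \<not> (\<exists>\<alpha>>0. \<forall>x. scalar_curvature g x \<le> - \<alpha>))"
proof -
  obtain G S T where "three_jet u G S T"
    using smooth_map_three_jet[OF \<open>smooth_map u\<close>] .
  then interpret three_jet u G S T .
  interpret normal_graph u G S T N
  proof
    show "unit_normal_field warped_metric (vertical_graph u) N"
      using assms(8) unfolding \<psi> .
    \<comment> \<open>The metric product with \<open>d_t = (1, 0)\<close> is the first
      component.\<close>
    show "fst (N p) < 0" for p
      using assms(9)[of p] by (simp add: warped_metric_def d_t_def)
  qed
  have H: "mean_curvature warped_metric (vertical_graph u) N p = H" for p
    using assms(10)[of p] unfolding \<psi> .
  have "H \<ge> 1"
    by (rule constant_mean_curvature_ge_1[OF H \<open>0 \<le> H\<close>])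
  with \<open>H \<le> 1\<close> have mean: "mean_curvature warped_metric (vertical_graph u) N p = 1" for p
    using H[of p] by simp
  have met: "g = met" unfolding g \<psi> by (rule induced_metric_eq)
  have "\<not> (\<exists>\<alpha>>0. \<forall>x. scalar_curvature g x \<le> - \<alpha>)"
    using scalar_curvature_close_to_0[OF mean assms(3)] unfolding met by (meson not_le)
  moreover have "\<forall>x. scalar_curvature g x \<le> 0"
    using scalar_curvature_nonpos[OF mean] unfolding met by blast
  ultimately show ?thesis using mean unfolding \<psi> by blast
qed

end
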